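(* The collection of all continua is not uniquely compactifiable; that is, there is no compact metrizable space $X$ such that every continuum is homeomorphic to exactly one component of $X$.
   Context: A continuum is a compact connected metrizable space. A collection $\mathcal C$ of continua is called uniquely compactifiable if there exists a compact metrizable space $X$ such that for every $C\in\mathcal C$ there exists a unique component $D$ of $X$ which is homeomorphic to $C$ (components of $X$ are not required to be homeomorphic to elements of $\mathcal C$). *)

theory Defs
  imports "HOL-Analysis.Analysis"
begin

text \<open>
  The empty topology satisfies \<^const>\<open>connected_space\<close>; as usual in continuum theory,
  a continuum is required to be nonempty.
\<close>
definition continuum :: "'a topology \<Rightarrow> bool" where
  "continuum C \<longleftrightarrow>
     topspace C \<noteq> {} \<and> compact_space C \<and> connected_space C \<and> metrizable_space C"

text \<open>
  The type argument is the type of the points of the compactifying space, since HOL cannot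
  quantify over types inside a definition.
\<close>
definition uniquely_compactifiable :: "'a itself \<Rightarrow> 'b topology set \<Rightarrow> bool" where
  "uniquely_compactifiable (_ :: 'a itself) \<C> \<longleftrightarrow>
     (\<exists>X :: 'a topology. compact_space X \<and> metrizable_space X \<and>
        (\<forall>C\<in>\<C>. \<exists>!D. D \<in> connected_components_of X \<and> subtopology X D homeomorphic_space C))"

text \<open>
  There is no set of all continua over all types. Every continuum has a homeomorphic copy whose
  points are real sequences, so the continua over that type represent all of them; this is
  \<open>continuum_copy_in_sequences\<close> below.
\<close>
definition all_continua :: "(nat \<Rightarrow> real) topology set" where
  "all_continua = {C. continuum C}"

lemma homeomorphic_continuum:
  assumes "C homeomorphic_space D" "continuum C"
  shows "continuum D"
  using assms(2) homeomorphic_compact_space[OF assms(1)] homeomorphic_connected_space[OF assms(1)]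
    homeomorphic_metrizable_space[OF assms(1)] homeomorphic_empty_space[OF assms(1)]
  by (simp add: continuum_def)

lemma continuum_copy_in_sequences:
  assumes "continuum (C :: 'b topology)"
  shows "\<exists>D \<in> all_continua. C homeomorphic_space D"
proof -
  obtain M d where "Metric_space M d" and C: "C = Metric_space.mtopology M d"
    using assms unfolding continuum_def metrizable_space_def by blast
  interpret Metric_space M d by fact
  have M: "M \<noteq> {}" "compact_space mtopology"
    using assms C by (auto simp: continuum_def)
  have "mtotally_bounded M"
    using M(2) compact_space_eq_mcomplete_mtotally_bounded by blast
  then have "\<forall>n. \<exists>K. finite K \<and> K \<subseteq> M \<and> M \<subseteq> (\<Union>x\<in>K. mball x (1 / real (Suc n)))"
    unfolding mtotally_bounded_def by simp
  then obtain K where K: "\<And>n. finite (K n)" "\<And>n. K n \<subseteq> M"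
      "\<And>n. M \<subseteq> (\<Union>x\<in>K n. mball x (1 / real (Suc n)))"
    by (atomize_elim, simp only: all_conj_distrib[symmetric]) (rule choice)
  define S where "S = (\<Union>n. K n)"
  have S: "countable S" "S \<subseteq> M" "S \<noteq> {}"
    using K(1,2) K(3)[of 0] M(1) by (auto simp: S_def countable_finite)
  define s where "s = from_nat_into S"
  have sM: "s n \<in> M" for n
    using S from_nat_into[of S n] by (auto simp: s_def)
  define f where "f = (\<lambda>x n. d x (s n))"
  have inj: "inj_on f M"
  proof (rule inj_onI, rule ccontr)
    fix x y assume xy: "x \<in> M" "y \<in> M" "f x = f y" "x \<noteq> y"
    then have pos: "d x y / 2 > 0" by simp
    then obtain n where n: "1 / real (Suc n) < d x y / 2"
      using nat_approx_posE by blast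
    obtain a where a: "a \<in> K n" "d a x < 1 / real (Suc n)"
      using K(3)[of n] xy(1) by (auto simp: subset_iff)
    then have "a \<in> S" by (auto simp: S_def)
    then obtain m where m: "s m = a"
      using from_nat_into_surj[OF S(1)] unfolding s_def by blast
    have "d x a = d y a" using xy(3) m by (auto simp: f_def fun_eq_iff)
    moreover have "d x y \<le> d x a + d a y"
      using triangle[of x a y] xy sM[of m] m by simp
    ultimately show False
      using a n commute[of a x] commute[of a y] by linarith
  qed
  have cont: "continuous_map mtopology (product_topology (\<lambda>_. euclideanreal) UNIV) f"
  proof (subst continuous_map_componentwise_UNIV, intro allI)
    fix n
    have eq: "mtopology_of (metric (M, d)) = mtopology"
      by (simp add: mtopology_of_def)
    have "continuous_map mtopology euclidean (\<lambda>x. mdist (metric (M, d)) x (s n))"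
      by (rule continuous_map_mdist) (use sM eq in auto)
    then show "continuous_map mtopology euclideanreal (\<lambda>x. f x n)"
      by (simp add: f_def)
  qed
  have "Hausdorff_space (product_topology (\<lambda>_::nat. euclideanreal) UNIV)"
    by (simp add: Hausdorff_space_product_topology)
  then have "embedding_map mtopology (product_topology (\<lambda>_. euclideanreal) UNIV) f"
    using continuous_imp_embedding_map cont M(2) inj by fastforce
  then have "C homeomorphic_space
      subtopology (product_topology (\<lambda>_. euclideanreal) UNIV) (f ` M)"
    using embedding_map_imp_homeomorphic_space C by fastforce
  then show ?thesis
    using homeomorphic_continuum assms by (auto simp: all_continua_def)
qed

end

(* A point x of the Baire space (int => nat) is encoded by a necklace C(x): a two-way infinite
   string of circles and segments, laid out along the real line and compactified by two end points, in
   which the n-th link contains a segment iff x n is nonzero. Shifting x does not change C(x) up to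
   homeomorphism; conversely, the order of the cut points of C(x) determines the support of x up to
   shifts and reflection, so every homeomorphism class is meager.
   Suppose that a compact metric space S has exactly one component c(x) homeomorphic to C(x), for
   each x. For U clopen in S the set A(U) = {x. c(x) <= U} is shift invariant and analytic, hence
   has the Baire property, so it is meager or comeager because the shift is topologically
   transitive. As S has only countably many clopen sets, and these separate its components, c is
   constant on a comeager set, which puts a comeager set into a single class. *)

theory Submission
  imports Defs
begin

section \<open>Meager sets and the Souslin operation\<close>

text \<open>The component \<open>c x\<close> would be a complete homeomorphism invariant of the
  necklace of \<open>x\<close>, with values in the space of components of \<open>S\<close>, which is
  compact and zero-dimensional. The shift is generically ergodic, so an invariant of this kind that
  is regular enough must be constant on a comeager set. The obstacle is regularity: \<open>c\<close>
  is given by bare existence, without any measurability. Uniqueness supplies it: that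
  \<open>c x\<close> lies in \<open>U\<close> becomes the statement that some component inside
  \<open>U\<close> is homeomorphic to the necklace, which is existential over sequences in a compact
  set, and its negation is the same statement for \<open>S - U\<close>. The Souslin operation takes
  care of such statements. Necklaces suit this because their points depend continuously on
  \<open>x\<close> and their cut points lie on a line, so that a homeomorphism induces a map of them
  preserving betweenness.\<close>

definition meager :: "'a::topological_space set \<Rightarrow> bool" where
  "meager A \<longleftrightarrow> (\<exists>\<G>. countable \<G> \<and> (\<forall>G\<in>\<G>. closed G \<and> interior G = {}) \<and> A \<subseteq> \<Union>\<G>)"

lemma meager_subset: "meager B \<Longrightarrow> A \<subseteq> B \<Longrightarrow> meager A"
  unfolding meager_def by (meson order_trans)

lemma meager_nowhere_dense: "closed G \<Longrightarrow> interior G = {} \<Longrightarrow> meager G"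
  unfolding meager_def by (intro exI[of _ "{G}"]) auto

lemma meager_closed_minus_interior:
  assumes "closed G"
  shows "meager (G - interior G)"
proof (rule meager_nowhere_dense)
  show "closed (G - interior G)"
    using assms by (simp add: closed_Diff)
  have "interior (G - interior G) \<subseteq> interior G"
    by (intro interior_mono) auto
  then show "interior (G - interior G) = {}"
    using interior_subset[of "G - interior G"] by blast
qed

lemma meager_Union:
  assumes "countable \<A>" "\<And>A. A \<in> \<A> \<Longrightarrow> meager A"
  shows "meager (\<Union>\<A>)"
proof -
  obtain g where g: "\<And>A. A \<in> \<A> \<Longrightarrow> countable (g A)"
      "\<And>A. A \<in> \<A> \<Longrightarrow> \<forall>G\<in>g A. closed G \<and> interior G = {}" "\<And>A. A \<in> \<A> \<Longrightarrow> A \<subseteq> \<Union>(g A)"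
    using assms(2) unfolding meager_def by metis
  have "countable (\<Union>A\<in>\<A>. g A)" using assms(1) g(1) by auto
  moreover have "\<Union>\<A> \<subseteq> \<Union>(\<Union>A\<in>\<A>. g A)" using g(3) by fastforce
  ultimately show ?thesis
    unfolding meager_def using g(2) by (intro exI[of _ "\<Union>A\<in>\<A>. g A"]) auto
qed

lemma meager_UN:
  "countable I \<Longrightarrow> (\<And>i. i \<in> I \<Longrightarrow> meager (A i)) \<Longrightarrow> meager (\<Union>i\<in>I. A i)"
  by (rule meager_Union) auto

lemma meager_Un:
  assumes "meager A" "meager B"
  shows "meager (A \<union> B)"
  using meager_Union[of "{A, B}"] assms by auto

lemma meager_empty [simp]: "meager {}"
  using meager_Union[of "{}"] by simp

lemma not_meager_open:
  assumes "completely_metrizable_space (euclidean :: 'a::topological_space topology)"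
    and "open W" "W \<noteq> {}"
  shows "\<not> meager (W :: 'a set)"
proof
  assume "meager W"
  then obtain \<G> :: "'a set set" where \<G>: "countable \<G>" "\<And>G. G \<in> \<G> \<Longrightarrow> closed G \<and> interior G = {}"
      "W \<subseteq> \<Union>\<G>"
    unfolding meager_def by blast
  have "euclidean interior_of \<Union>\<G> = ({} :: 'a set)"
    by (rule Baire_category_alt) (use assms(1) \<G> in auto)
  then have "interior (\<Union>\<G>) = {}" by simp
  moreover have "W \<subseteq> interior (\<Union>\<G>)" using \<G>(3) assms(2) by (rule interior_maximal)
  ultimately show False using assms(3) by blast
qed

text \<open>The points at which \<open>A\<close> is locally nonmeager. It serves as the closed hull
  of \<open>A\<close> modulo meager sets.\<close>

definition heart :: "'a::topological_space set \<Rightarrow> 'a set" where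
  "heart A = - \<Union>{V. open V \<and> meager (V \<inter> A)}"

lemma closed_heart: "closed (heart A)"
  unfolding heart_def by (intro closed_Compl open_Union) auto

text \<open>By the Lindelof property, countably many of the open sets in which \<open>A\<close> is
  meager already cover the union of all of them, so what \<open>A\<close> loses outside its heart is
  a countable union of meager sets.\<close>

lemma meager_diff_heart:
  fixes A :: "'a::second_countable_topology set"
  shows "meager (A - heart A)"
proof -
  let ?\<V> = "{V. open V \<and> meager (V \<inter> A)}"
  obtain \<V> where \<V>: "\<V> \<subseteq> ?\<V>" "countable \<V>" "\<Union>\<V> = \<Union>?\<V>"
    using Lindelof[of ?\<V>] by auto
  have "meager (\<Union>V\<in>\<V>. V \<inter> A)" using \<V> by (intro meager_UN) auto
  moreover have "A - heart A = (\<Union>V\<in>\<V>. V \<inter> A)" using \<V>(3) by (auto simp: heart_def)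
  ultimately show ?thesis by simp
qed

lemma heart_disjoint: "open V \<Longrightarrow> meager (V \<inter> A) \<Longrightarrow> V \<inter> heart A = {}"
  unfolding heart_def by blast

text \<open>
  The Souslin operation preserves the Baire property. A point of \<open>heart A\<close> outside the meager
  sets \<open>M s\<close> lies on an infinite branch of the hearts \<open>H s\<close>, and is therefore in \<open>A\<close>.
\<close>

lemma Souslin_heart:
  fixes K :: "'m::countable list \<Rightarrow> 'a::second_countable_topology set"
  assumes K: "\<And>s. closed (K s)"
    and A: "A = {x. \<exists>\<sigma>::nat \<Rightarrow> 'm. \<forall>n. x \<in> K (map \<sigma> [0..<n])}"
  shows "meager (heart A - A)"
proof -
  \<comment> \<open>\<open>B s\<close> is the part of \<open>A\<close> reached by branches that
    start with \<open>s\<close>. These parts need not be closed; \<open>H s\<close> is a closed set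
    that covers \<open>B s\<close> up to a meager set.\<close>
  define B where "B s = {x. \<exists>\<sigma>::nat \<Rightarrow> 'm. map \<sigma> [0..<length s] = s \<and> (\<forall>n. x \<in> K (map \<sigma> [0..<n]))}" for s
  define H where "H s = K s \<inter> heart (B s)" for s
  have clH: "closed (H s)" for s
    unfolding H_def by (intro closed_Int K closed_heart)
  have BK: "B s \<subseteq> K s" for s
  proof
    fix x assume "x \<in> B s"
    then obtain \<sigma> where \<sigma>: "map \<sigma> [0..<length s] = s" "\<forall>n. x \<in> K (map \<sigma> [0..<n])"
      unfolding B_def by blast
    show "x \<in> K s" using spec[OF \<sigma>(2), of "length s"] unfolding \<sigma>(1) .
  qed
  have BH: "meager (B s - H s)" for s
    by (rule meager_subset[OF meager_diff_heart[of "B s"]]) (use BK[of s] in \<open>auto simp: H_def\<close>)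
  have BUN: "B s \<subseteq> (\<Union>m. B (s @ [m]))" for s
  proof
    fix x assume "x \<in> B s"
    then obtain \<sigma> where \<sigma>: "map \<sigma> [0..<length s] = s" "\<forall>n. x \<in> K (map \<sigma> [0..<n])"
      unfolding B_def by blast
    then have "x \<in> B (s @ [\<sigma> (length s)])"
      unfolding B_def by (intro CollectI exI[of _ \<sigma>]) simp
    then show "x \<in> (\<Union>m. B (s @ [m]))" by blast
  qed
  define M where "M s = H s - (\<Union>m. H (s @ [m]))" for s
  have M: "meager (M s)" for s
  proof -
    \<comment> \<open>\<open>D\<close> is a closed set containing \<open>M s\<close>, and it is
      nowhere dense: inside \<open>V\<close>, the pieces \<open>B (s @ [m])\<close> of
      \<open>B s\<close> are contained, up to meager sets, in interiors that \<open>D\<close>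
      avoids. So \<open>B s\<close> is meager in \<open>V\<close> and \<open>V\<close> misses
      \<open>heart (B s)\<close>, although \<open>V\<close> is a subset of it.\<close>
    define D where "D = heart (B s) - (\<Union>m. interior (H (s @ [m])))"
    have "closed D"
      unfolding D_def by (intro closed_Diff closed_heart open_UN) auto
    define V where "V = interior D"
    have "V \<inter> B s \<subseteq> (\<Union>m. B (s @ [m]) - H (s @ [m])) \<union> (\<Union>m. H (s @ [m]) - interior (H (s @ [m])))"
    proof
      fix x assume "x \<in> V \<inter> B s"
      then have "x \<in> D" "x \<in> (\<Union>m. B (s @ [m]))"
        using BUN[of s] interior_subset[of D] by (auto simp: V_def)
      then show "x \<in> (\<Union>m. B (s @ [m]) - H (s @ [m])) \<union> (\<Union>m. H (s @ [m]) - interior (H (s @ [m])))"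
        unfolding D_def by blast
    qed
    moreover have "meager \<dots>"
      by (intro meager_Un meager_UN BH meager_closed_minus_interior clH) auto
    ultimately have "meager (V \<inter> B s)" by (rule meager_subset[rotated])
    then have "V \<inter> heart (B s) = {}"
      by (intro heart_disjoint) (simp_all add: V_def)
    moreover have "V \<subseteq> heart (B s)"
      using interior_subset[of D] unfolding V_def D_def by blast
    ultimately have "interior D = {}" unfolding V_def by blast
    then have "meager D" using \<open>closed D\<close> by (rule meager_nowhere_dense[rotated])
    moreover have "M s \<subseteq> D"
    proof -
      have "interior (H (s @ [m])) \<subseteq> H (s @ [m])" for m by (rule interior_subset)
      then show ?thesis unfolding M_def D_def H_def[of s] by blast
    qed
    ultimately show ?thesis by (rule meager_subset)
  qed
  have B0: "B [] = A" unfolding B_def A by simp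
  have "heart A \<subseteq> K []"
  proof -
    have "- K [] \<inter> A = {}" using BK[of "[]"] B0 by auto
    then have "meager (- K [] \<inter> A)" by simp
    then have "- K [] \<inter> heart A = {}" by (intro heart_disjoint) (simp_all add: K open_Compl)
    then show ?thesis by blast
  qed
  then have H0: "H [] = heart A" unfolding H_def B0 by blast
  have "heart A - A \<subseteq> (\<Union>s. M s)"
  proof (rule subsetI, rule ccontr)
    fix x assume x: "x \<in> heart A - A" and nM: "x \<notin> (\<Union>s. M s)"
    then have step: "\<exists>m. x \<in> H (s @ [m])" if "x \<in> H s" for s
      using that unfolding M_def by blast
    define nxt where "nxt s = s @ [SOME m. x \<in> H (s @ [m])]" for s
    define t where "t n = (nxt ^^ n) []" for n
    have tH: "x \<in> H (t n)" for n
    proof (induction n)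
      case 0 then show ?case using x H0 by (simp add: t_def)
    next
      case (Suc n)
      then show ?case using someI_ex[OF step[OF Suc]] by (simp add: t_def nxt_def)
    qed
    have len: "length (t n) = n" for n
      by (induction n) (simp_all add: t_def nxt_def)
    define \<sigma> where "\<sigma> n = last (t (Suc n))" for n
    have "map \<sigma> [0..<n] = t n" for n
      by (induction n) (simp_all add: t_def nxt_def \<sigma>_def)
    moreover have "x \<in> K (t n)" for n using tH[of n] by (simp add: H_def)
    ultimately have "\<forall>n. x \<in> K (map \<sigma> [0..<n])" by simp
    then have "x \<in> A" unfolding A by blast
    then show False using x by blast
  qed
  moreover have "meager (\<Union>s. M s)" by (intro meager_UN M) auto
  ultimately show ?thesis by (rule meager_subset[rotated])
qed

text \<open>\<open>A\<close> is the projection along the compact set \<open>Q\<close> of a countable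
  intersection of countable unions of closed sets. Compactness keeps the projections
  \<open>K s\<close> closed and lets one witness \<open>b\<close> serve a whole branch, so
  \<open>A\<close> arises from the sets \<open>K s\<close> by the Souslin operation. The open set
  found is the interior of \<open>heart A\<close>.\<close>

lemma Souslin_nonmeager:
  fixes R :: "nat \<Rightarrow> 'm::countable \<Rightarrow> 'a::second_countable_topology \<Rightarrow> 'b::t2_space \<Rightarrow> bool"
  assumes Q: "compact Q"
    and R: "\<And>i m. closed {(x, b). b \<in> Q \<and> R i m x b}"
    and A: "A = {x. \<exists>b\<in>Q. \<forall>i. \<exists>m. R i m x b}"
    and nm: "\<not> meager A"
  shows "\<exists>V. open V \<and> V \<noteq> {} \<and> meager (V - A)"
proof -
  define T where "T s = {(x, b). b \<in> Q \<and> (\<forall>i<length s. R i (s ! i) x b)}" for s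
  define K where "K s = fst ` T s" for s
  have clT: "closed (T s)" for s
  proof -
    have "T s = (UNIV \<times> Q) \<inter> (\<Inter>i\<in>{..<length s}. {(x, b). b \<in> Q \<and> R i (s ! i) x b})"
      unfolding T_def by auto
    then show ?thesis
      using R compact_imp_closed[OF Q] by (auto intro!: closed_Int closed_INT closed_Times)
  qed
  have K: "closed (K s)" for s
  proof -
    have "closedin (prod_topology euclidean (top_of_set Q)) (T s)"
    proof -
      have "prod_topology (euclidean :: 'a topology) (top_of_set Q) = top_of_set (UNIV \<times> Q)"
        using prod_topology_subtopology_eu[of UNIV Q] by simp
      then show ?thesis
        using clT[of s] by (simp add: T_def closed_subset subset_iff)
    qed
    moreover have "closed_map (prod_topology euclidean (top_of_set Q)) (euclidean :: 'a topology) fst"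
      by (rule closed_map_fst) (use Q in \<open>simp add: compact_space_subtopology\<close>)
    ultimately show ?thesis
      unfolding closed_map_def K_def by (metis closed_closedin)
  qed
  have Aeq: "A = {x. \<exists>\<sigma>::nat \<Rightarrow> 'm. \<forall>n. x \<in> K (map \<sigma> [0..<n])}"
  proof (intro set_eqI iffI)
    fix x assume "x \<in> A"
    then obtain b where b: "b \<in> Q" "\<forall>i. \<exists>m. R i m x b" unfolding A by blast
    then obtain \<sigma> where "\<forall>i. R i (\<sigma> i) x b" by metis
    then have "(x, b) \<in> T (map \<sigma> [0..<n])" for n using b(1) by (simp add: T_def)
    then show "x \<in> {x. \<exists>\<sigma>::nat \<Rightarrow> 'm. \<forall>n. x \<in> K (map \<sigma> [0..<n])}"
      unfolding K_def by force
  next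
    fix x assume "x \<in> {x. \<exists>\<sigma>::nat \<Rightarrow> 'm. \<forall>n. x \<in> K (map \<sigma> [0..<n])}"
    then obtain \<sigma> :: "nat \<Rightarrow> 'm" where \<sigma>: "\<And>n. x \<in> K (map \<sigma> [0..<n])" by blast
    \<comment> \<open>The possible witnesses after \<open>n\<close> conditions: decreasing compact
      fibres, nonempty because \<open>x\<close> lies in every
      \<open>K (map \<sigma> [0..<n])\<close>, hence with a common point.\<close>
    define L where "L n = {b. (x, b) \<in> T (map \<sigma> [0..<n])}" for n
    have Ldec: "L n \<subseteq> L m" if "m \<le> n" for m n
      using that unfolding L_def T_def by auto
    have "Q \<inter> (\<Inter>n\<in>UNIV. L n) \<noteq> {}"
    proof (rule compact_imp_fip_image[OF Q])
      fix n
      have "L n = (\<lambda>b. (x, b)) -` T (map \<sigma> [0..<n])" unfolding L_def by auto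
      then show "closed (L n)"
        using clT by (auto intro!: continuous_closed_vimage continuous_intros)
    next
      fix I :: "nat set" assume I: "finite I" "I \<subseteq> UNIV"
      obtain b where b: "b \<in> L (Max (insert 0 I))"
        using \<sigma>[of "Max (insert 0 I)"] unfolding K_def L_def by auto
      then have "b \<in> L i" if "i \<in> I" for i
        using Ldec[of i "Max (insert 0 I)"] that I by auto
      moreover have "b \<in> Q" using b unfolding L_def T_def by auto
      ultimately show "Q \<inter> (\<Inter>n\<in>I. L n) \<noteq> {}" by auto
    qed
    then obtain b where b: "b \<in> Q" "\<And>n. b \<in> L n" by auto
    have "R i (\<sigma> i) x b" for i
      using b(2)[of "Suc i"] unfolding L_def T_def by (auto simp del: upt_Suc)
    then show "x \<in> A" unfolding A using b(1) by blast
  qed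
  have meag: "meager (heart A - A)" by (rule Souslin_heart[OF K Aeq])
  define V where "V = interior (heart A)"
  have "V \<noteq> {}"
  proof
    assume "V = {}"
    then have "meager (heart A)"
      unfolding V_def by (intro meager_nowhere_dense closed_heart)
    then have "meager (heart A \<union> (A - heart A))"
      by (intro meager_Un meager_diff_heart)
    then show False using nm meager_subset by blast
  qed
  moreover have "meager (V - A)"
    using meager_subset[OF meag] interior_subset[of "heart A"] unfolding V_def by blast
  ultimately show ?thesis unfolding V_def by blast
qed

section \<open>Components homeomorphic to a given continuum\<close>

text \<open>The closure of the graph of \<open>a k \<mapsto> b k\<close> replaces the extension of
  this map to the closure of its domain. It is compact, and \<open>mod\<close> makes the first
  projection injective on it, so this projection is a homeomorphism.\<close>

lemma graph_closure_fst:
  fixes a :: "nat \<Rightarrow> 'c::metric_space" and b :: "nat \<Rightarrow> 'x::metric_space"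
  assumes "compact (closure (range a))" "compact (closure (range b))"
    and mod: "\<And>i. \<exists>m. \<forall>j k. dist (a j) (a k) < inverse (real (Suc m)) \<longrightarrow>
                 dist (b j) (b k) \<le> inverse (real (Suc i))"
  shows "closure (range a) homeomorphic closure (range (\<lambda>k. (a k, b k)))"
proof -
  define G where "G = closure (range (\<lambda>k. (a k, b k)))"
  have sub: "G \<subseteq> closure (range a) \<times> closure (range b)"
    unfolding G_def closure_Times[symmetric] by (intro closure_mono) auto
  have "compact G"
    using compact_Int_closed[OF compact_Times[OF assms(1,2)], of G] sub
    by (simp add: G_def inf.absorb2)
  have img: "fst ` G = closure (range a)"
  proof
    show "fst ` G \<subseteq> closure (range a)" using sub by auto
    have "closed (fst ` G)"
      by (intro compact_imp_closed compact_continuous_image \<open>compact G\<close> continuous_intros)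
    moreover have "range a \<subseteq> fst ` G"
      using closure_subset[of "range (\<lambda>k. (a k, b k))"] unfolding G_def by force
    ultimately show "closure (range a) \<subseteq> fst ` G" by (rule closure_minimal[rotated])
  qed
  have "inj_on fst G"
  proof (rule inj_onI)
    fix p q assume p: "p \<in> G" and q: "q \<in> G" and eq: "fst p = fst q"
    have "dist (snd p) (snd q) \<le> e" if "e > 0" for e
    proof -
      obtain i where i: "inverse (real (Suc i)) < e / 3"
        using reals_Archimedean[of "e / 3"] \<open>e > 0\<close> by auto
      obtain m where m: "\<And>j k. dist (a j) (a k) < inverse (real (Suc m)) \<Longrightarrow>
                 dist (b j) (b k) \<le> inverse (real (Suc i))" using mod by blast
      define r where "r = min (inverse (real (Suc m)) / 2) (e / 3)"
      have "r > 0" using \<open>e > 0\<close> by (simp add: r_def)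
      obtain j where j: "dist (a j, b j) p < r"
        using p \<open>r > 0\<close> unfolding G_def closure_approachable by auto
      obtain k where k: "dist (a k, b k) q < r"
        using q \<open>r > 0\<close> unfolding G_def closure_approachable by auto
      have d: "dist (a j) (fst p) < r" "dist (b j) (snd p) < r"
              "dist (a k) (fst q) < r" "dist (b k) (snd q) < r"
        using j k dist_fst_le[of "(a j, b j)" p] dist_snd_le[of "(a j, b j)" p]
          dist_fst_le[of "(a k, b k)" q] dist_snd_le[of "(a k, b k)" q] by auto
      have "dist (a j) (a k) \<le> dist (a j) (fst p) + dist (a k) (fst q)"
        using dist_triangle2[of "a j" "a k" "fst p"] eq by simp
      then have "dist (a j) (a k) < inverse (real (Suc m))"
        using d unfolding r_def by linarith
      then have "dist (b j) (b k) \<le> inverse (real (Suc i))" by (rule m)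
      moreover have "dist (snd p) (snd q) \<le> dist (b j) (snd p) + dist (b j) (b k) + dist (b k) (snd q)"
        using dist_triangle3[of "snd p" "snd q" "b j"] dist_triangle[of "b j" "snd q" "b k"] by simp
      ultimately show ?thesis using d i unfolding r_def by linarith
    qed
    then have "dist (snd p) (snd q) \<le> 0" by (rule field_le_epsilon) simp
    then show "p = q" using eq by (simp add: prod_eq_iff)
  qed
  then have "G homeomorphic closure (range a)"
    by (intro homeomorphic_compact[OF \<open>compact G\<close> _ img] continuous_intros)
  then show ?thesis unfolding G_def by (rule homeomorphic_sym[THEN iffD1])
qed

text \<open>Both closures are homeomorphic to the closure of the graph, one of them through the
  graph of the inverse correspondence and a swap of coordinates.\<close>

lemma closure_range_homeomorphic:
  fixes a :: "nat \<Rightarrow> 'c::metric_space" and b :: "nat \<Rightarrow> 'x::metric_space"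
  assumes cpt: "compact (closure (range a))" "compact (closure (range b))"
    and ab: "\<And>i. \<exists>m. \<forall>j k. dist (a j) (a k) < inverse (real (Suc m)) \<longrightarrow>
                 dist (b j) (b k) \<le> inverse (real (Suc i))"
    and ba: "\<And>i. \<exists>m. \<forall>j k. dist (b j) (b k) < inverse (real (Suc m)) \<longrightarrow>
                 dist (a j) (a k) \<le> inverse (real (Suc i))"
  shows "closure (range a) homeomorphic closure (range b)"
proof -
  note 1 = graph_closure_fst[OF cpt ab]
  note 2 = graph_closure_fst[OF cpt(2,1) ba]
  let ?G = "closure (range (\<lambda>k. (a k, b k)))" and ?H = "closure (range (\<lambda>k. (b k, a k)))"
  have sw: "prod.swap ` closure (range (\<lambda>k. (f k, g k))) \<subseteq> closure (range (\<lambda>k. (g k, f k)))"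
    for f :: "nat \<Rightarrow> 'u::metric_space" and g :: "nat \<Rightarrow> 'v::metric_space"
  proof (rule image_closure_subset)
    show "prod.swap ` range (\<lambda>k. (f k, g k)) \<subseteq> closure (range (\<lambda>k. (g k, f k)))"
      using closure_subset[of "range (\<lambda>k. (g k, f k))"] by auto
  qed (simp_all add: continuous_on_swap)
  have 3: "?G homeomorphic ?H"
    unfolding homeomorphic_minimal
    using sw[of a b] sw[of b a]
    by (intro exI[of _ prod.swap]) (simp add: continuous_on_swap image_subset_iff)
  show ?thesis
    using homeomorphic_trans[OF homeomorphic_trans[OF 1 3]] 2 homeomorphic_sym by blast
qed

text \<open>Uniform continuity with a strict bound in the premise and a weak one in the conclusion,
  so that for fixed \<open>m\<close> and \<open>i\<close> the implication is a closed condition on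
  the points.\<close>

lemma modulus_of_continuity:
  fixes h :: "'c::metric_space \<Rightarrow> 'x::metric_space"
  assumes "compact C" "continuous_on C h" "range a \<subseteq> C"
  shows "\<exists>m. \<forall>j k. dist (a j) (a k) < inverse (real (Suc m)) \<longrightarrow>
                 dist (h (a j)) (h (a k)) \<le> inverse (real (Suc i))"
proof -
  have "uniformly_continuous_on C h" using assms compact_uniformly_continuous by blast
  moreover have "inverse (real (Suc i)) > 0" by simp
  ultimately obtain d where d: "d > 0"
    "\<And>x y. x \<in> C \<Longrightarrow> y \<in> C \<Longrightarrow> dist y x < d \<Longrightarrow> dist (h y) (h x) < inverse (real (Suc i))"
    unfolding uniformly_continuous_on_def by metis
  obtain m where m: "inverse (real (Suc m)) < d" using reals_Archimedean[OF d(1)] by blast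
  have aC: "a k \<in> C" for k using assms(3) by blast
  have "dist (a j) (a k) < inverse (real (Suc m)) \<Longrightarrow> dist (h (a j)) (h (a k)) \<le> inverse (real (Suc i))" for j k
    using d(2)[OF aC[of k] aC[of j]] m by linarith
  then show ?thesis by blast
qed

section \<open>Clopen subsets and components of a compact set\<close>

definition clopen_in :: "'a::topological_space set \<Rightarrow> 'a set set" where
  "clopen_in S = {V. openin (top_of_set S) V \<and> closedin (top_of_set S) V}"

text \<open>A clopen subset of \<open>S\<close> is compact, hence the trace of a finite union of
  basic open sets, and a countable base has only countably many finite subfamilies.\<close>

lemma countable_clopen_in:
  fixes S :: "'a::{t2_space, second_countable_topology} set"
  assumes "compact S"
  shows "countable (clopen_in S)"
proof -
  obtain B :: "'a set set" where B: "countable B" "topological_basis B"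
    using ex_countable_basis by blast
  have "clopen_in S \<subseteq> (\<lambda>F. S \<inter> \<Union>F) ` {F. finite F \<and> F \<subseteq> B}"
  proof
    fix V assume "V \<in> clopen_in S"
    then have V: "openin (top_of_set S) V" "closedin (top_of_set S) V"
      by (auto simp: clopen_in_def)
    obtain U where U: "open U" "V = S \<inter> U" using V(1) by (auto simp: openin_open)
    obtain B' where B': "B' \<subseteq> B" "\<Union>B' = U"
      using B(2) U(1) by (metis topological_basis)
    have "compact V" using V(2) assms closedin_compact by blast
    moreover have "V \<subseteq> \<Union>B'" using U B' by blast
    moreover have "open W" if "W \<in> B'" for W
      using topological_basis_open[OF B(2)] B'(1) that by blast
    ultimately obtain F where F: "F \<subseteq> B'" "finite F" "V \<subseteq> \<Union>F"
      by (rule compactE)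
    have "\<Union>F \<subseteq> U" using F(1) B'(2) by blast
    then have "V = S \<inter> \<Union>F" using F(3) U(2) by blast
    then show "V \<in> (\<lambda>F. S \<inter> \<Union>F) ` {F. finite F \<and> F \<subseteq> B}"
      using F(1,2) B'(1) by (intro image_eqI[of _ _ F]) auto
  qed
  then show ?thesis
    by (rule countable_subset) (intro countable_image countable_Collect_finite_subset B(1))
qed

text \<open>In a compact Hausdorff space components coincide with quasi-components. The separation
  obtained consists of two open sets, so the part containing \<open>D\<close> is also
  closed.\<close>

lemma component_clopen_neighbourhood:
  fixes S :: "'a::metric_space set"
  assumes "compact S" "D \<in> connected_components_of (top_of_set S)" "open W" "D \<subseteq> W"
  obtains V where "V \<in> clopen_in S" "D \<subseteq> V" "V \<subseteq> W"
proof -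
  have S: "compact_space (top_of_set S)" "Hausdorff_space (top_of_set S)"
    using assms(1) by (auto simp: compact_space_subtopology intro: Hausdorff_space_subtopology)
  have "D \<subseteq> S" using connected_components_of_subset[OF assms(2)] by simp
  obtain U V where UV: "openin (top_of_set S) U" "openin (top_of_set S) V" "disjnt U V"
      "U \<union> V = topspace (top_of_set S)" "D \<subseteq> U" "U \<subseteq> S \<inter> W"
  proof (rule wilder_locally_compact_component_thm[of "top_of_set S" D "S \<inter> W"])
    show "locally_compact_space (top_of_set S)" using S compact_imp_locally_compact_space by blast
    show "compactin (top_of_set S) D"
      using S closedin_compact_space closedin_connected_components_of[OF assms(2)] by blast
  qed (use assms S \<open>D \<subseteq> S\<close> in \<open>auto simp: openin_open\<close>)
  have "U = S - V" using UV unfolding disjnt_def by auto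
  then have "closedin (top_of_set S) U" using UV(2) by auto
  then show ?thesis using UV by (intro that[of U]) (auto simp: clopen_in_def)
qed

lemma clopen_in_component:
  assumes "V \<in> clopen_in S" "D \<in> connected_components_of (top_of_set S)" "D \<inter> V \<noteq> {}"
  shows "D \<subseteq> V"
  using connectedin_clopen_cases[OF connectedin_connected_components_of[OF assms(2)], of V] assms
  by (auto simp: clopen_in_def disjnt_def)

text \<open>
  Here \<open>a\<close> is a dense sequence of a continuum and \<open>b\<close> is the candidate for its image in a
  component of \<open>S\<close>. The first two clauses are moduli of continuity for \<open>a k \<mapsto> b k\<close> and for its
  inverse; the last ones force the closure of \<open>range b\<close> to be a whole component, namely that
  of \<open>b 0\<close>. Only closed conditions occur, so that only the quantifiers over \<open>V\<close>, \<open>m\<close> and \<open>n\<close>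
  stand between the homeomorphism relation and a closed set.
\<close>

definition component_code ::
  "nat \<Rightarrow> 'x::metric_space set \<Rightarrow> 'x set \<Rightarrow> nat \<Rightarrow> nat \<Rightarrow> (nat \<Rightarrow> 'c::metric_space) \<Rightarrow> (nat \<Rightarrow> 'x) \<Rightarrow> bool" where
  "component_code i U V m n a b \<longleftrightarrow>
     (\<forall>j k. inverse (real (Suc m)) \<le> dist (a j) (a k) \<or> dist (b j) (b k) \<le> inverse (real (Suc i))) \<and>
     (\<forall>j k. inverse (real (Suc m)) \<le> dist (b j) (b k) \<or> dist (a j) (a k) \<le> inverse (real (Suc i))) \<and>
     b 0 \<in> U \<and> b 0 \<in> V \<and> (\<forall>v\<in>V. \<exists>k\<in>{..n}. dist v (b k) \<le> inverse (real (Suc i)))"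

text \<open>Given a homeomorphism \<open>h\<close>, take \<open>b k = h (a k)\<close>; a clopen
  neighbourhood of the component inside the balls about the \<open>b k\<close> is compact, which
  bounds \<open>n\<close>. Conversely the moduli make the closure of \<open>range b\<close> a
  homeomorphic copy, hence connected and contained in the component of \<open>b 0\<close>. Every
  clopen set containing \<open>b 0\<close> contains this component, which therefore lies within
  \<open>inverse (real (Suc i))\<close> of \<open>range b\<close> for all \<open>i\<close>.\<close>

lemma component_code_iff:
  fixes S :: "'x::metric_space set" and a :: "nat \<Rightarrow> 'c::metric_space"
  assumes S: "compact S" and U: "U \<in> clopen_in S"
    and a: "compact (closure (range a))" "connected (closure (range a))"
  shows "(\<exists>D\<in>connected_components_of (top_of_set S). D \<subseteq> U \<and> closure (range a) homeomorphic D) \<longleftrightarrow>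
         (\<exists>b. (\<forall>k. b k \<in> S) \<and> (\<forall>i. \<exists>V\<in>clopen_in S. \<exists>m n. component_code i U V m n a b))"
proof (intro iffI)
  assume "\<exists>D\<in>connected_components_of (top_of_set S). D \<subseteq> U \<and> closure (range a) homeomorphic D"
  then obtain D g h where D: "D \<in> connected_components_of (top_of_set S)" "D \<subseteq> U"
    and h: "homeomorphism (closure (range a)) D h g"
    unfolding homeomorphic_def by blast
  define b where "b k = h (a k)" for k
  have aC: "range a \<subseteq> closure (range a)" by (rule closure_subset)
  have aC': "a k \<in> closure (range a)" for k using aC by blast
  have bD: "b k \<in> D" for k using homeomorphism_image1[OF h] aC'[of k] unfolding b_def by blast
  have "D \<subseteq> S" using connected_components_of_subset[OF D(1)] by simp
  have cptD: "compact D"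
    using compact_continuous_image[OF homeomorphism_cont1[OF h] a(1)] homeomorphism_image1[OF h] by simp
  have dense: "D \<subseteq> closure (range b)"
  proof -
    have "h ` closure (range a) \<subseteq> closure (range b)"
      using h aC by (intro image_closure_subset closed_closure)
        (auto simp: homeomorphism_def b_def closure_subset[THEN subsetD])
    then show ?thesis using h by (simp add: homeomorphism_def)
  qed
  have gb: "g (b k) = a k" for k unfolding b_def by (rule homeomorphism_apply1[OF h aC'])
  have "\<exists>V\<in>clopen_in S. \<exists>m n. component_code i U V m n a b" for i
  proof -
    let ?e = "inverse (real (Suc i))"
    obtain m1 where m1: "\<And>j k. dist (a j) (a k) < inverse (real (Suc m1)) \<Longrightarrow> dist (b j) (b k) \<le> ?e"
      using modulus_of_continuity[OF a(1) homeomorphism_cont1[OF h] aC, of i] unfolding b_def by blast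
    have "\<exists>m. \<forall>j k. dist (b j) (b k) < inverse (real (Suc m)) \<longrightarrow> dist (g (b j)) (g (b k)) \<le> ?e"
      using bD by (intro modulus_of_continuity[OF cptD homeomorphism_cont2[OF h]]) auto
    then obtain m2 where m2: "\<And>j k. dist (b j) (b k) < inverse (real (Suc m2)) \<Longrightarrow> dist (a j) (a k) \<le> ?e"
      unfolding gb by blast
    define m where "m = max m1 m2"
    have m: "inverse (real (Suc m)) \<le> inverse (real (Suc m1))" "inverse (real (Suc m)) \<le> inverse (real (Suc m2))"
      unfolding m_def by (auto intro!: le_imp_inverse_le)
    have "D \<subseteq> (\<Union>k. ball (b k) ?e)"
    proof
      fix x assume "x \<in> D"
      then obtain k where "dist (b k) x < ?e"
        using dense closure_approachable[of x "range b"] by force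
      then show "x \<in> (\<Union>k. ball (b k) ?e)" by auto
    qed
    then obtain V where V: "V \<in> clopen_in S" "D \<subseteq> V" "V \<subseteq> (\<Union>k. ball (b k) ?e)"
      using component_clopen_neighbourhood[OF S D(1), of "\<Union>k. ball (b k) ?e"] by (metis open_UN open_ball)
    have "compact V" using V(1) S closedin_compact unfolding clopen_in_def by blast
    then obtain K where K: "finite K" "V \<subseteq> (\<Union>k\<in>K. ball (b k) ?e)"
      using V(3) compactE_image[of V UNIV "\<lambda>k. ball (b k) ?e"] by auto
    define n where "n = Max (insert 0 K)"
    have "\<exists>k\<in>{..n}. dist v (b k) \<le> ?e" if "v \<in> V" for v
    proof -
      have "v \<in> (\<Union>k\<in>K. ball (b k) ?e)" using K(2) that by blast
      then obtain k where "k \<in> K" "dist (b k) v < ?e" by auto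
      then show ?thesis using K(1)
        by (intro bexI[of _ k]) (auto simp: n_def dist_commute)
    qed
    then have "component_code i U V m n a b"
      unfolding component_code_def
    proof (intro conjI allI)
      fix j k
      show "inverse (real (Suc m)) \<le> dist (a j) (a k) \<or> dist (b j) (b k) \<le> ?e"
        using m1[of j k] m(1) by linarith
      show "inverse (real (Suc m)) \<le> dist (b j) (b k) \<or> dist (a j) (a k) \<le> ?e"
        using m2[of j k] m(2) by linarith
    qed (use bD[of 0] D(2) V(2) in auto)
    then show ?thesis using V(1) by blast
  qed
  then show "\<exists>b. (\<forall>k. b k \<in> S) \<and> (\<forall>i. \<exists>V\<in>clopen_in S. \<exists>m n. component_code i U V m n a b)"
    using bD \<open>D \<subseteq> S\<close> by blast
next
  assume "\<exists>b. (\<forall>k. b k \<in> S) \<and> (\<forall>i. \<exists>V\<in>clopen_in S. \<exists>m n. component_code i U V m n a b)"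
  then obtain b where bS: "\<And>k. b k \<in> S"
    and b: "\<And>i. \<exists>V\<in>clopen_in S. \<exists>m n. component_code i U V m n a b" by blast
  define B where "B = closure (range b)"
  have "B \<subseteq> S" unfolding B_def using bS compact_imp_closed[OF S] by (intro closure_minimal) auto
  then have "compact B"
    using compact_Int_closed[OF S, of B] by (simp add: B_def inf.absorb2)
  have hom: "closure (range a) homeomorphic B"
    unfolding B_def
  proof (rule closure_range_homeomorphic[OF a(1)])
    show "compact (closure (range b))" using \<open>compact B\<close> by (simp add: B_def)
  next
    fix i
    obtain V m n where "component_code i U V m n a b" using b by blast
    then show "\<exists>m. \<forall>j k. dist (a j) (a k) < inverse (real (Suc m)) \<longrightarrow> dist (b j) (b k) \<le> inverse (real (Suc i))"
      and "\<exists>m. \<forall>j k. dist (b j) (b k) < inverse (real (Suc m)) \<longrightarrow> dist (a j) (a k) \<le> inverse (real (Suc i))"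
      unfolding component_code_def by (metis linorder_not_le)+
  qed
  then have "connected B" using a(2) homeomorphic_connectedness by blast
  define D where "D = connected_component_of_set (top_of_set S) (b 0)"
  have D: "D \<in> connected_components_of (top_of_set S)"
    unfolding D_def using bS by (simp add: connected_component_in_connected_components_of)
  have b0: "b 0 \<in> D" unfolding D_def using bS by (simp add: connected_component_of_refl)
  have b0B: "b 0 \<in> B" unfolding B_def using closure_subset by fast
  have "B \<subseteq> D" unfolding D_def
    by (rule connected_component_of_maximal) (use b0B \<open>connected B\<close> \<open>B \<subseteq> S\<close> in \<open>auto simp: connectedin_subtopology\<close>)
  moreover have "D \<subseteq> B"
  proof
    fix x assume "x \<in> D"
    show "x \<in> B" unfolding B_def closure_approachable
    proof (intro allI impI)
      fix e :: real assume "e > 0"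
      then obtain i where i: "inverse (real (Suc i)) < e" using reals_Archimedean by blast
      obtain V m n where V: "V \<in> clopen_in S" and c: "component_code i U V m n a b" using b by blast
      have "D \<subseteq> V" using clopen_in_component[OF V D] b0 c unfolding component_code_def by blast
      then obtain k where "dist x (b k) \<le> inverse (real (Suc i))"
        using c \<open>x \<in> D\<close> unfolding component_code_def by blast
      then show "\<exists>y\<in>range b. dist y x < e" using i by (auto simp: dist_commute intro!: exI[of _ k])
    qed
  qed
  moreover have "D \<subseteq> U"
  proof -
    have "b 0 \<in> U" using b[of 0] unfolding component_code_def by blast
    then show ?thesis using clopen_in_component[OF U D] b0 by blast
  qed
  ultimately show "\<exists>D\<in>connected_components_of (top_of_set S). D \<subseteq> U \<and> closure (range a) homeomorphic D"
    using hom D by (intro bexI[of _ D]) auto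
qed

lemma closed_component_code:
  fixes U V :: "'x::metric_space set" and a :: "nat \<Rightarrow> 'p::topological_space \<Rightarrow> 'c::metric_space"
  assumes cont: "\<And>k. continuous_on UNIV (a k)" and "closed U" "closed V"
  shows "closed {(x, b). component_code i U V m n (\<lambda>k. a k x) b}"
proof -
  have [continuous_intros]: "continuous_on UNIV (\<lambda>p::'p \<times> (nat \<Rightarrow> 'x). a k (fst p))" for k
    by (rule continuous_on_compose2[OF cont]) (auto intro: continuous_intros)
  have [continuous_intros]: "continuous_on UNIV (\<lambda>p::'p \<times> (nat \<Rightarrow> 'x). snd p k)" for k
    by (rule continuous_on_product_then_coordinatewise) (intro continuous_intros)
  have vim: "closed {p::'p \<times> (nat \<Rightarrow> 'x). snd p 0 \<in> T}" if "closed T" for T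
    using closed_vimage[OF that, of "\<lambda>p::'p \<times> (nat \<Rightarrow> 'x). snd p 0"]
    by (simp add: vimage_def continuous_intros)
  have ex: "closed {p::'p \<times> (nat \<Rightarrow> 'x). \<exists>k\<in>{..n}. dist v (snd p k) \<le> inverse (real (Suc i))}" for v
  proof -
    have "{p::'p \<times> (nat \<Rightarrow> 'x). \<exists>k\<in>{..n}. dist v (snd p k) \<le> inverse (real (Suc i))} =
       (\<Union>k\<in>{..n}. {p. dist v (snd p k) \<le> inverse (real (Suc i))})" by blast
    then show ?thesis by (auto intro!: closed_UN closed_Collect_le continuous_intros)
  qed
  have "{p::'p \<times> (nat \<Rightarrow> 'x). \<forall>v\<in>V. \<exists>k\<in>{..n}. dist v (snd p k) \<le> inverse (real (Suc i))} =
      (\<Inter>v\<in>V. {p. \<exists>k\<in>{..n}. dist v (snd p k) \<le> inverse (real (Suc i))})" by blast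
  then have bl: "closed {p::'p \<times> (nat \<Rightarrow> 'x). \<forall>v\<in>V. \<exists>k\<in>{..n}. dist v (snd p k) \<le> inverse (real (Suc i))}"
    using ex by auto
  show ?thesis
    unfolding component_code_def case_prod_beta'
    by (intro closed_Collect_conj closed_Collect_all closed_Collect_disj closed_Collect_le
        continuous_intros vim assms bl)
qed

lemma component_dichotomy:
  fixes S :: "'x::{metric_space, second_countable_topology} set"
    and a :: "nat \<Rightarrow> 'p::second_countable_topology \<Rightarrow> 'c::metric_space"
  assumes S: "compact S" and U: "U \<in> clopen_in S"
    and cont: "\<And>k. continuous_on UNIV (a k)"
    and C: "\<And>x. C x = closure (range (\<lambda>k. a k x))" "\<And>x. compact (C x)" "\<And>x. connected (C x)"
    and A: "A = {x. \<exists>D\<in>connected_components_of (top_of_set S). D \<subseteq> U \<and> C x homeomorphic D}"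
    and nm: "\<not> meager A"
  shows "\<exists>V. open V \<and> V \<noteq> {} \<and> meager (V - A)"
proof -
  define W where "W = from_nat_into (clopen_in S)"
  have W: "range W = clopen_in S"
    unfolding W_def using U countable_clopen_in[OF S] by (intro range_from_nat_into) auto
  define Q where "Q = {b::nat \<Rightarrow> 'x. \<forall>k. b k \<in> S}"
  \<comment> \<open>The clopen set is replaced by its index \<open>v\<close>, so that the witness
    for each \<open>i\<close> is a triple of naturals and ranges over a countable type.\<close>
  define R where "R i w x b = (case w of (v, m, n) \<Rightarrow> component_code i U (W v) m n (\<lambda>k. a k x) b)" for i w x b
  have clS: "closed V" if "V \<in> clopen_in S" for V
    using that closedin_closed_trans compact_imp_closed[OF S] unfolding clopen_in_def by blast
  have Q: "compact Q"
  proof -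
    have "Q = (\<Pi>\<^sub>E k\<in>UNIV. S)" by (auto simp: Q_def)
    then show ?thesis
      using compactin_PiE[of "\<lambda>_. euclidean" UNIV "\<lambda>_. S"] S
      by (simp add: euclidean_product_topology)
  qed
  show ?thesis
  proof (rule Souslin_nonmeager[OF Q _ _ nm])
    show "closed {(x, b). b \<in> Q \<and> R i w x b}" for i w
    proof (cases w)
      case (fields v m n)
      have "{(x, b). b \<in> Q \<and> R i w x b} =
          (UNIV \<times> Q) \<inter> {(x, b). component_code i U (W v) m n (\<lambda>k. a k x) b}"
        by (auto simp: R_def fields)
      moreover have "closed {(x, b). component_code i U (W v) m n (\<lambda>k. a k x) b}"
        by (rule closed_component_code[OF cont]) (use clS U W in auto)
      ultimately show ?thesis
        using compact_imp_closed[OF Q] by (simp add: closed_Int closed_Times)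
    qed
    show "A = {x. \<exists>b\<in>Q. \<forall>i. \<exists>w. R i w x b}"
    proof (intro set_eqI)
      fix x
      have "x \<in> A \<longleftrightarrow> (\<exists>b\<in>Q. \<forall>i. \<exists>V\<in>range W. \<exists>m n. component_code i U V m n (\<lambda>k. a k x) b)"
        using component_code_iff[OF S U, of "\<lambda>k. a k x"] C(2,3)[of x] unfolding A C(1) Q_def W by auto
      then show "x \<in> A \<longleftrightarrow> x \<in> {x. \<exists>b\<in>Q. \<forall>i. \<exists>w. R i w x b}"
        by (simp add: R_def)
    qed
  qed
qed

section \<open>Necklaces and their cut points\<close>

definition separates :: "'a::topological_space set \<Rightarrow> 'a \<Rightarrow> 'a \<Rightarrow> 'a \<Rightarrow> bool" where
  "separates N r p q \<longleftrightarrow> r \<in> N \<and> p \<in> N - {r} \<and> q \<in> N - {r} \<and>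
     \<not> (\<exists>T. connected T \<and> T \<subseteq> N - {r} \<and> p \<in> T \<and> q \<in> T)"

lemma separates_homeomorphism_imp:
  assumes h: "homeomorphism N N' h g" and "separates N' (h r) (h p) (h q)"
    and N: "r \<in> N" "p \<in> N" "q \<in> N"
  shows "separates N r p q"
proof -
  have inj: "inj_on h N" using h by (metis homeomorphism_def inj_on_inverseI)
  have "\<not> (\<exists>T. connected T \<and> T \<subseteq> N - {r} \<and> p \<in> T \<and> q \<in> T)"
  proof
    assume "\<exists>T. connected T \<and> T \<subseteq> N - {r} \<and> p \<in> T \<and> q \<in> T"
    then obtain T where T: "connected T" "T \<subseteq> N - {r}" "p \<in> T" "q \<in> T" by blast
    have "connected (h ` T)"
      using T by (intro connected_continuous_image continuous_on_subset[OF homeomorphism_cont1[OF h]]) auto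
    moreover have "h ` T \<subseteq> N' - {h r}"
      using T(2) inj N(1) homeomorphism_image1[OF h] by (auto dest: inj_onD)
    ultimately show False using assms(2) T(3,4) unfolding separates_def by blast
  qed
  then show ?thesis using assms(2) N unfolding separates_def by auto
qed

lemma separates_homeomorphism:
  assumes h: "homeomorphism N N' h g" and N: "r \<in> N" "p \<in> N" "q \<in> N"
  shows "separates N' (h r) (h p) (h q) \<longleftrightarrow> separates N r p q"
proof
  assume "separates N r p q"
  then have "separates N (g (h r)) (g (h p)) (g (h q))"
    using h N by (simp add: homeomorphism_def)
  then show "separates N' (h r) (h p) (h q)"
    by (rule separates_homeomorphism_imp[OF homeomorphism_symD[OF h]])
       (use h N in \<open>auto simp: homeomorphism_def\<close>)
qed (rule separates_homeomorphism_imp[OF h _ N])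

text \<open>The graphs of \<open>w\<close> and \<open>- w\<close>, glued where \<open>w\<close>
  vanishes. For a nonnegative profile vanishing at 0 and 1, a maximal interval of positivity
  contributes a circle, and an interval of zeros contributes a segment on the axis.\<close>

definition necklace :: "(real \<Rightarrow> real) \<Rightarrow> (real \<times> real) set" where
  "necklace w = {(t, s). t \<in> {0..1} \<and> \<bar>s\<bar> = w t}"

locale bead_profile =
  fixes w :: "real \<Rightarrow> real"
  assumes cont: "continuous_on {0..1} w"
    and nonneg: "t \<in> {0..1} \<Longrightarrow> 0 \<le> w t"
    and w_0 [simp]: "w 0 = 0" and w_1 [simp]: "w 1 = 0"
begin

definition arc :: "real \<Rightarrow> real set \<Rightarrow> (real \<times> real) set" where
  "arc e I = (\<lambda>t. (t, e * w t)) ` I"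

lemma connected_arc: "0 \<le> a \<Longrightarrow> b \<le> 1 \<Longrightarrow> connected (arc e {a..b})"
  unfolding arc_def
  by (intro connected_continuous_image continuous_intros continuous_on_subset[OF cont]) auto

lemma arc_subset_necklace: "e \<in> {1, -1} \<Longrightarrow> I \<subseteq> {0..1} \<Longrightarrow> arc e I \<subseteq> necklace w"
  unfolding arc_def necklace_def using nonneg by auto

lemma necklace_cases:
  assumes "p \<in> necklace w"
  obtains e t where "e \<in> {1, -1}" "t \<in> {0..1}" "p = (t, e * w t)"
proof -
  obtain t s where p: "p = (t, s)" "t \<in> {0..1}" "\<bar>s\<bar> = w t"
    using assms unfolding necklace_def by blast
  then have "s = 1 * w t \<or> s = -1 * w t" by linarith
  then show ?thesis using that p by blast
qed

lemma necklace_eq_arcs: "necklace w = arc 1 {0..1} \<union> arc (-1) {0..1}"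
proof
  show "necklace w \<subseteq> arc 1 {0..1} \<union> arc (-1) {0..1}"
    by (rule subsetI, erule necklace_cases) (auto simp: arc_def)
qed (use arc_subset_necklace in auto)

lemma compact_necklace: "compact (necklace w)"
  unfolding necklace_eq_arcs arc_def
  by (intro compact_Un compact_continuous_image continuous_intros cont) auto

lemma arc_0: "0 \<le> b \<Longrightarrow> (0, 0) \<in> arc e {0..b}"
  unfolding arc_def by (auto intro!: image_eqI[of _ _ 0])

lemma arc_1: "a \<le> 1 \<Longrightarrow> (1, 0) \<in> arc e {a..1}"
  unfolding arc_def by (auto intro!: image_eqI[of _ _ 1])

lemma connected_necklace: "connected (necklace w)"
  unfolding necklace_eq_arcs
  using arc_0[of 1 1] arc_0[of 1 "-1"] by (intro connected_Un connected_arc) auto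

text \<open>Each of the two points runs leftwards along its own branch to \<open>(0, 0)\<close>, and
  both paths stay over abscissae smaller than \<open>t\<close>.\<close>

lemma not_separates_zero:
  assumes "fst p < t" "fst q < t" "p \<in> necklace w" "q \<in> necklace w"
  shows "\<not> separates (necklace w) (t, s) p q"
proof -
  obtain e a where p: "e \<in> {1, -1}" "a \<in> {0..1}" "p = (a, e * w a)" using assms(3) by (rule necklace_cases)
  obtain f b where q: "f \<in> {1, -1}" "b \<in> {0..1}" "q = (b, f * w b)" using assms(4) by (rule necklace_cases)
  define T where "T = arc e {0..a} \<union> arc f {0..b}"
  have "connected T"
    unfolding T_def using arc_0[of a e] arc_0[of b f] p(2) q(2) by (intro connected_Un connected_arc) auto
  moreover have "T \<subseteq> necklace w"
    unfolding T_def using p(1,2) q(1,2) by (intro Un_least arc_subset_necklace) auto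
  moreover have "(t, s) \<notin> T" using assms(1,2) p(3) q(3) by (auto simp: T_def arc_def)
  moreover have "p \<in> T" "q \<in> T" using p q by (auto simp: T_def arc_def)
  ultimately show ?thesis unfolding separates_def by blast
qed

lemma not_separates_one:
  assumes "fst p > t" "fst q > t" "p \<in> necklace w" "q \<in> necklace w"
  shows "\<not> separates (necklace w) (t, s) p q"
proof -
  obtain e a where p: "e \<in> {1, -1}" "a \<in> {0..1}" "p = (a, e * w a)" using assms(3) by (rule necklace_cases)
  obtain f b where q: "f \<in> {1, -1}" "b \<in> {0..1}" "q = (b, f * w b)" using assms(4) by (rule necklace_cases)
  define T where "T = arc e {a..1} \<union> arc f {b..1}"
  have "connected T"
    unfolding T_def using arc_1[of a e] arc_1[of b f] p(2) q(2) by (intro connected_Un connected_arc) auto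
  moreover have "T \<subseteq> necklace w"
    unfolding T_def using p(1,2) q(1,2) by (intro Un_least arc_subset_necklace) auto
  moreover have "(t, s) \<notin> T" using assms(1,2) p(3) q(3) by (auto simp: T_def arc_def)
  moreover have "p \<in> T" "q \<in> T" using p q by (auto simp: T_def arc_def)
  ultimately show ?thesis unfolding separates_def by blast
qed

text \<open>The opposite branch \<open>L\<close> is connected and avoids \<open>r\<close>. Any other
  point on the branch of \<open>r\<close> reaches \<open>L\<close> at one of the two ends, by
  running away from \<open>r\<close>.\<close>

lemma not_separates_off_axis:
  assumes "s \<noteq> 0" "r = (t, s)"
  shows "\<not> separates (necklace w) r p q"
proof
  assume sep: "separates (necklace w) r p q"
  then have r: "r \<in> necklace w" by (simp add: separates_def)
  obtain e where e: "e \<in> {1, -1}" "t \<in> {0..1}" "s = e * w t"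
    using necklace_cases[OF r] assms(2) by (metis Pair_inject)
  define L where "L = arc (-e) {0..1}"
  have L: "connected L" "L \<subseteq> necklace w - {r}"
    using e assms connected_arc[of 0 1 "-e"] arc_subset_necklace[of "-e" "{0..1}"]
    by (auto simp: L_def arc_def)
  have ex: "\<exists>T. connected T \<and> T \<subseteq> necklace w - {r} \<and> L \<subseteq> T \<and> x \<in> T" if x: "x \<in> necklace w - {r}" for x
  proof -
    obtain f a where f: "f \<in> {1, -1}" "a \<in> {0..1}" "x = (a, f * w a)"
      using x necklace_cases[of x] by blast
    show ?thesis
    proof (cases "f = e")
      case False
      then have "x \<in> L" using f e by (auto simp: L_def arc_def)
      then show ?thesis using L by blast
    next
      case True
      then have "a \<noteq> t" using x f assms(2) e by auto
      then consider "a < t" | "a > t" by linarith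
      then show ?thesis
      proof cases
        case 1
        have "connected (L \<union> arc e {0..a})"
          using arc_0[of a e] arc_0[of 1 "-e"] f L
          by (intro connected_Un connected_arc) (auto simp: L_def)
        moreover have "arc e {0..a} \<subseteq> necklace w - {r}"
          using arc_subset_necklace[of e "{0..a}"] e f 1 assms(2) by (auto simp: arc_def)
        ultimately show ?thesis using L f True
          by (intro exI[of _ "L \<union> arc e {0..a}"]) (auto simp: arc_def)
      next
        case 2
        have "connected (L \<union> arc e {a..1})"
          using arc_1[of a e] arc_1[of 0 "-e"] f L
          by (intro connected_Un connected_arc) (auto simp: L_def)
        moreover have "arc e {a..1} \<subseteq> necklace w - {r}"
          using arc_subset_necklace[of e "{a..1}"] e f 2 assms(2) by (auto simp: arc_def)
        ultimately show ?thesis using L f True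
          by (intro exI[of _ "L \<union> arc e {a..1}"]) (auto simp: arc_def)
      qed
    qed
  qed
  have pq: "p \<in> necklace w - {r}" "q \<in> necklace w - {r}" using sep by (simp_all add: separates_def)
  obtain T where T: "connected T" "T \<subseteq> necklace w - {r}" "L \<subseteq> T" "p \<in> T" using ex[OF pq(1)] by blast
  obtain T' where T': "connected T'" "T' \<subseteq> necklace w - {r}" "L \<subseteq> T'" "q \<in> T'" using ex[OF pq(2)] by blast
  have "L \<noteq> {}" by (auto simp: L_def arc_def)
  then have "connected (T \<union> T')" using T T' by (intro connected_Un) auto
  then show False using sep T T' unfolding separates_def by (meson Un_iff Un_least)
qed

lemma eq_if_on_axis:
  assumes "r \<in> necklace w" "x \<in> necklace w" "snd r = 0" "fst x = fst r"
  shows "x = r"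
proof -
  have "w (fst r) = 0" using assms(1,3) by (auto simp: necklace_def)
  then have "snd x = 0" using assms(2,4) by (auto simp: necklace_def)
  then show ?thesis using assms(3,4) by (simp add: prod_eq_iff)
qed

text \<open>Over the abscissa of a pinch there is only the pinch itself, so a connected set avoiding
  it projects to an interval that misses this abscissa. For the other direction, the preceding
  detours join the two points whenever \<open>r\<close> is off the axis or both lie on the same side
  of it.\<close>

lemma separates_necklace:
  assumes "r \<in> necklace w" "p \<in> necklace w" "q \<in> necklace w"
  shows "separates (necklace w) r p q \<longleftrightarrow>
    snd r = 0 \<and> (fst p < fst r \<and> fst r < fst q \<or> fst q < fst r \<and> fst r < fst p)"
proof
  assume sep: "separates (necklace w) r p q"
  then have 0: "snd r = 0" using not_separates_off_axis by (metis prod.collapse)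
  have "p \<noteq> r" "q \<noteq> r" using sep by (simp_all add: separates_def)
  then have "fst p \<noteq> fst r" "fst q \<noteq> fst r"
    using eq_if_on_axis[OF assms(1) _ 0] assms(2,3) by blast+
  moreover have "\<not> (fst p < fst r \<and> fst q < fst r)" "\<not> (fst p > fst r \<and> fst q > fst r)"
    using not_separates_zero[of p "fst r" q "snd r"] not_separates_one[of "fst r" p q "snd r"] sep assms
    by auto
  ultimately show "snd r = 0 \<and> (fst p < fst r \<and> fst r < fst q \<or> fst q < fst r \<and> fst r < fst p)"
    using 0 by linarith
next
  assume *: "snd r = 0 \<and> (fst p < fst r \<and> fst r < fst q \<or> fst q < fst r \<and> fst r < fst p)"
  have "\<not> (connected T \<and> T \<subseteq> necklace w - {r} \<and> p \<in> T \<and> q \<in> T)" for T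
  proof
    assume T: "connected T \<and> T \<subseteq> necklace w - {r} \<and> p \<in> T \<and> q \<in> T"
    then have "connected (fst ` T)"
      by (intro connected_continuous_image continuous_intros) auto
    moreover have "fst p \<in> fst ` T" "fst q \<in> fst ` T" using T by simp_all
    ultimately have "fst r \<in> fst ` T"
      using * connectedD_interval[of "fst ` T"] by (meson less_imp_le)
    then obtain x where "x \<in> T" "fst x = fst r" by auto
    moreover have "x \<in> necklace w" "x \<noteq> r" using T \<open>x \<in> T\<close> by auto
    ultimately show False using eq_if_on_axis[OF assms(1)] * by blast
  qed
  moreover have "p \<noteq> r" "q \<noteq> r" using * by auto
  ultimately show "separates (necklace w) r p q" using assms unfolding separates_def by blast
qed

lemma necklace_eq_closure:
  assumes "closure D = {0..1}"
  shows "necklace w = closure (\<Union>e\<in>{1, -1}. arc e D)"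
proof
  have D: "D \<subseteq> {0..1}" using assms closure_subset by blast
  show "necklace w \<subseteq> closure (\<Union>e\<in>{1, -1}. arc e D)"
  proof
    fix p assume "p \<in> necklace w"
    then obtain e t where e: "e \<in> {1, -1}" "t \<in> {0..1}" "p = (t, e * w t)" by (rule necklace_cases)
    have "(\<lambda>t. (t, e * w t)) ` closure D \<subseteq> closure (arc e D)"
      unfolding arc_def assms
      by (rule image_closure_subset[of D, unfolded assms]) (auto intro!: continuous_intros cont closure_subset)
    then have "p \<in> closure (arc e D)" using e assms by auto
    then show "p \<in> closure (\<Union>e\<in>{1, -1}. arc e D)"
      using closure_mono[of "arc e D" "\<Union>e\<in>{1, -1}. arc e D"] e(1) by blast
  qed
  show "closure (\<Union>e\<in>{1, -1}. arc e D) \<subseteq> necklace w"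
    using D arc_subset_necklace by (intro closure_minimal compact_imp_closed compact_necklace) blast
qed

end

text \<open>The homeomorphism moves abscissae by \<open>f\<close> and stretches the fibre over
  \<open>t\<close> by \<open>c t\<close>, so the profiles may differ by a positive continuous
  factor.\<close>

lemma homeomorphic_necklace:
  assumes "bead_profile w" "continuous_on {0..1} f" "continuous_on {0..1} c"
    and f: "bij_betw f {0..1} {0..1}" and c: "\<And>t. t \<in> {0..1} \<Longrightarrow> c t > 0"
    and w': "\<And>t. t \<in> {0..1} \<Longrightarrow> w' (f t) = c t * w t"
  shows "necklace w homeomorphic necklace w'"
proof (rule homeomorphic_compact)
  interpret bead_profile w by fact
  show "compact (necklace w)" by (rule compact_necklace)
  let ?h = "\<lambda>p. (f (fst p), c (fst p) * snd p)"
  have sub: "fst ` necklace w \<subseteq> {0..1}" by (auto simp: necklace_def)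
  show "continuous_on (necklace w) ?h"
    by (intro continuous_intros continuous_on_compose2[OF assms(2)] continuous_on_compose2[OF assms(3)] sub)
  have fin: "f t \<in> {0..1}" if "t \<in> {0..1}" for t using f that bij_betwE by blast
  show "?h ` necklace w = necklace w'"
  proof
    show "?h ` necklace w \<subseteq> necklace w'"
    proof
      fix q assume "q \<in> ?h ` necklace w"
      then obtain t s where "q = (f t, c t * s)" "t \<in> {0..1}" "\<bar>s\<bar> = w t" by (auto simp: necklace_def)
      then show "q \<in> necklace w'"
        using fin[of t] w'[of t] c[of t] by (simp add: necklace_def abs_mult)
    qed
    show "necklace w' \<subseteq> ?h ` necklace w"
    proof
      fix q assume "q \<in> necklace w'"
      then obtain u s where q: "q = (u, s)" "u \<in> {0..1}" "\<bar>s\<bar> = w' u" by (auto simp: necklace_def)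
      have "u \<in> f ` {0..1}" using f q(2) by (simp add: bij_betw_def)
      then obtain t where t: "t \<in> {0..1}" "f t = u" by blast
      have "\<bar>s / c t\<bar> = w t" using c[OF t(1)] w'[OF t(1)] q(3) t(2) by (simp add: field_simps)
      then have "(t, s / c t) \<in> necklace w" using t by (simp add: necklace_def)
      moreover have "q = ?h (t, s / c t)" using c[OF t(1)] t q by simp
      ultimately show "q \<in> ?h ` necklace w" by (rule rev_image_eqI)
    qed
  qed
  show "inj_on ?h (necklace w)"
  proof (rule inj_onI)
    fix p q assume p: "p \<in> necklace w" and q: "q \<in> necklace w" and eq: "?h p = ?h q"
    have "fst p \<in> {0..1}" "fst q \<in> {0..1}" using p q sub by blast+
    then have "fst p = fst q" using eq f by (auto simp: bij_betw_def dest: inj_onD)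
    moreover have "c (fst p) > 0" using c sub p by blast
    ultimately show "p = q" using eq by (simp add: prod_eq_iff)
  qed
qed

section \<open>Rigidity of the pinch points\<close>

text \<open>\<open>u\<close> is the middle point, in the same argument position as in
  \<open>separates\<close>. The relation is unoriented since a homeomorphism of necklaces may
  reverse the line.\<close>

definition between :: "real \<Rightarrow> real \<Rightarrow> real \<Rightarrow> bool" where
  "between u v z \<longleftrightarrow> v < u \<and> u < z \<or> z < u \<and> u < v"

text \<open>
  The real coordinates at which the necklace of \<open>x\<close> is pinched. Integers are recognised among them
  as the points with a neighbour on either side, and \<open>x n \<noteq> 0\<close> as the presence of a further
  point between \<open>n\<close> and \<open>n + 1\<close>.
\<close>

definition beadset :: "(int \<Rightarrow> nat) \<Rightarrow> real set" where
  "beadset x = {u. frac u = 0 \<or> x \<lfloor>u\<rfloor> \<noteq> 0 \<and> 1/3 \<le> frac u \<and> frac u \<le> 2/3}"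

lemma of_int_in_beadset [simp]: "of_int n \<in> beadset x"
  by (simp add: beadset_def)

lemma beadset_gap:
  assumes "of_int n < u" "u < of_int n + 1"
  shows "u \<in> beadset x \<longleftrightarrow> x n \<noteq> 0 \<and> of_int n + 1/3 \<le> u \<and> u \<le> of_int n + 2/3"
proof -
  have "\<lfloor>u\<rfloor> = n" using assms by (simp add: floor_unique)
  then show ?thesis using assms unfolding beadset_def frac_def by auto
qed

lemma beadset_between_ints:
  "(\<exists>u\<in>beadset x. of_int n < u \<and> u < of_int n + 1) \<longleftrightarrow> x n \<noteq> 0"
proof
  assume "x n \<noteq> 0"
  then show "\<exists>u\<in>beadset x. of_int n < u \<and> u < of_int n + 1"
    using beadset_gap[of n "of_int n + 1/2" x] by (intro bexI[of _ "of_int n + 1/2"]) auto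
qed (use beadset_gap in blast)

lemma closed_beadset: "closed (beadset x)"
proof -
  have "open (- beadset x)"
  proof (subst open_subopen, intro ballI)
    fix u assume u: "u \<in> - beadset x"
    define n where "n = \<lfloor>u\<rfloor>"
    define T where "T = (if x n \<noteq> 0 then {of_int n <..< of_int n + 1} - {of_int n + 1/3 .. of_int n + 2/3}
      else {of_int n <..< of_int n + 1 :: real})"
    have "open T" unfolding T_def by (auto intro: open_Diff)
    have "frac u \<noteq> 0" using u by (auto simp: beadset_def)
    then have "of_int n < u" unfolding n_def frac_def by (smt (verit) of_int_floor_le)
    moreover have "u < of_int n + 1" unfolding n_def by linarith
    ultimately have "u \<in> T" using u beadset_gap[of n u x] by (auto simp: T_def)
    moreover have "T \<subseteq> - beadset x"
      using beadset_gap[of n _ x] by (auto simp: T_def split: if_splits)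
    ultimately show "\<exists>T. open T \<and> u \<in> T \<and> T \<subseteq> - beadset x" using \<open>open T\<close> by blast
  qed
  then show ?thesis by (simp add: closed_def)
qed

definition adjacent :: "real set \<Rightarrow> real \<Rightarrow> real \<Rightarrow> bool" where
  "adjacent Z u v \<longleftrightarrow> u \<in> Z \<and> v \<in> Z \<and> u \<noteq> v \<and> (\<forall>z\<in>Z. \<not> between z u v)"

lemma adjacent_right: "\<exists>v>of_int n. adjacent (beadset x) (of_int n) v"
proof (cases "x n = 0")
  case True
  then have "adjacent (beadset x) (of_int n) (of_int (n + 1))"
    using beadset_between_ints[of x n] of_int_in_beadset[of "n + 1" x]
    by (auto simp: adjacent_def between_def)
  then show ?thesis by (intro exI[of _ "of_int (n + 1)"]) auto
next
  case False
  then have "adjacent (beadset x) (of_int n) (of_int n + 1/3)"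
    using beadset_gap[of n "of_int n + 1/3" x] beadset_gap[of n _ x]
    by (force simp: adjacent_def between_def)
  then show ?thesis by (intro exI[of _ "of_int n + 1/3"]) auto
qed

lemma adjacent_left: "\<exists>v<of_int n. adjacent (beadset x) (of_int n) v"
proof (cases "x (n - 1) = 0")
  case True
  then have "adjacent (beadset x) (of_int n) (of_int (n - 1))"
    using beadset_between_ints[of x "n - 1"] of_int_in_beadset[of "n - 1" x]
    by (auto simp: adjacent_def between_def)
  then show ?thesis by (intro exI[of _ "of_int (n - 1)"]) auto
next
  case False
  then have "adjacent (beadset x) (of_int n) (of_int n - 1/3)"
    using beadset_gap[of "n - 1" "of_int n - 1/3" x] beadset_gap[of "n - 1" _ x]
    by (force simp: adjacent_def between_def)
  then show ?thesis by (intro exI[of _ "of_int n - 1/3"]) auto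
qed

lemma adjacent_same_side:
  assumes "adjacent Z u v" "adjacent Z u v'" "u < v \<longleftrightarrow> u < v'"
  shows "v = v'"
proof (rule ccontr)
  assume "v \<noteq> v'"
  moreover have "\<not> between v' u v" "\<not> between v u v'" "u \<noteq> v" "u \<noteq> v'"
    using assms(1,2) by (simp_all add: adjacent_def)
  ultimately show False using assms(3) unfolding between_def by linarith
qed

text \<open>Segments stay in the middle thirds, so an integer is isolated in the set from both
  sides. Any other point of the set lies in a nondegenerate segment of it, which accumulates at the
  point from at least one side and rules out a neighbour there.\<close>

lemma Ints_iff_two_neighbours:
  "u \<in> \<int> \<longleftrightarrow> (\<exists>v v'. v \<noteq> v' \<and> adjacent (beadset x) u v \<and> adjacent (beadset x) u v')"
proof
  assume "u \<in> \<int>"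
  then obtain n where "u = of_int n" by (auto elim: Ints_cases)
  then show "\<exists>v v'. v \<noteq> v' \<and> adjacent (beadset x) u v \<and> adjacent (beadset x) u v'"
    using adjacent_left[of n x] adjacent_right[of n x] by (metis order.asym)
next
  assume "\<exists>v v'. v \<noteq> v' \<and> adjacent (beadset x) u v \<and> adjacent (beadset x) u v'"
  then obtain v v' where v: "v \<noteq> v'" "adjacent (beadset x) u v" "adjacent (beadset x) u v'" by blast
  have "(u < v) \<noteq> (u < v')" using adjacent_same_side[OF v(2,3)] v(1) by blast
  moreover have "u \<noteq> v" "u \<noteq> v'" using v by (simp_all add: adjacent_def)
  ultimately have "v < u \<and> u < v' \<or> v' < u \<and> u < v" by linarith
  then obtain l r where lr: "adjacent (beadset x) u l" "l < u" "adjacent (beadset x) u r" "u < r"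
    using v by blast
  show "u \<in> \<int>"
  proof (rule ccontr)
    assume "u \<notin> \<int>"
    define n where "n = \<lfloor>u\<rfloor>"
    have "u \<noteq> of_int n" using \<open>u \<notin> \<int>\<close> by auto
    then have n: "of_int n < u" "u < of_int n + 1"
      using of_int_floor_le[of u] floor_less_iff[of u "n + 1"] unfolding n_def by linarith+
    have "u \<in> beadset x" using lr(1) by (simp add: adjacent_def)
    then have u: "x n \<noteq> 0" "of_int n + 1/3 \<le> u" "u \<le> of_int n + 2/3" using beadset_gap[OF n] by auto
    have seg: "z \<in> beadset x" if "of_int n + 1/3 \<le> z" "z \<le> of_int n + 2/3" for z
      using beadset_gap[of n z x] that u(1) by auto
    show False
    proof (cases "u = of_int n + 1/3")
      case True
      \<comment> \<open>Halfway to the alleged right neighbour, but not beyond the end of the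
        segment.\<close>
      have "min ((u + r) / 2) (of_int n + 2/3) \<in> beadset x" using True lr(4) by (intro seg) auto
      then show False using lr(3,4) True unfolding adjacent_def between_def by (auto simp: min_def split: if_splits)
    next
      case False
      have "max ((u + l) / 2) (of_int n + 1/3) \<in> beadset x" using u lr(2) by (intro seg) auto
      then show False using lr(1,2) False u unfolding adjacent_def between_def by (auto simp: max_def split: if_splits)
    qed
  qed
qed

text \<open>Injectivity forbids turning back, so all steps have the same sign.\<close>

lemma int_unit_steps:
  fixes f :: "int \<Rightarrow> int"
  assumes inj: "inj f" and step: "\<And>n. \<bar>f (n + 1) - f n\<bar> = 1"
  shows "(\<forall>n. f n = f 0 + n) \<or> (\<forall>n. f n = f 0 - n)"
proof -
  define e where "e = f 1 - f 0"
  have d: "f (n + 1) - f n = f n - f (n - 1)" for n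
  proof -
    have "f (n + 1) \<noteq> f (n - 1)" using inj by (simp add: inj_eq)
    then show ?thesis using step[of n] step[of "n - 1"] by auto
  qed
  have "f (n + 1) - f n = e" for n
  proof (induction n rule: int_induct[where k = 0])
    case base then show ?case by (simp add: e_def)
  next
    case (step1 i) then show ?case using d[of "i + 1"] by simp
  next
    case (step2 i) then show ?case using d[of i] by simp
  qed
  note e = this
  have *: "f n = f 0 + e * n" for n
  proof (induction n rule: int_induct[where k = 0])
    case base then show ?case by simp
  next
    case (step1 i) then show ?case using e[of i] by (simp add: algebra_simps)
  next
    case (step2 i) then show ?case using e[of "i - 1"] by (simp add: algebra_simps)
  qed
  have "e = 1 \<or> e = -1" using step[of 0] by (auto simp: e_def)
  then show ?thesis
  proof
    assume "e = 1"
    have "f n = f 0 + n" for n unfolding *[of n] \<open>e = 1\<close> by simp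
    then show ?thesis by blast
  next
    assume "e = -1"
    have "f n = f 0 - n" for n unfolding *[of n] \<open>e = -1\<close> by simp
    then show ?thesis by blast
  qed
qed

text \<open>Adjacency is expressed by betweenness, so \<psi> respects it and therefore maps integers
  to integers. An integer strictly between the images of \<open>n\<close> and \<open>n + 1\<close>
  would come from an integer strictly between \<open>n\<close> and \<open>n + 1\<close>, so the
  induced map \<open>f\<close> makes unit steps.\<close>

lemma beadset_rigid:
  assumes bij: "bij_betw \<psi> (beadset x) (beadset y)"
    and btw: "\<And>u v z. u \<in> beadset x \<Longrightarrow> v \<in> beadset x \<Longrightarrow> z \<in> beadset x \<Longrightarrow>
      between (\<psi> u) (\<psi> v) (\<psi> z) \<longleftrightarrow> between u v z"
  shows "\<exists>k. (\<forall>n. x n \<noteq> 0 \<longleftrightarrow> y (k + n) \<noteq> 0) \<or> (\<forall>n. x n \<noteq> 0 \<longleftrightarrow> y (k - n) \<noteq> 0)"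
proof -
  have inj: "inj_on \<psi> (beadset x)" and img: "\<psi> ` beadset x = beadset y"
    using bij by (auto simp: bij_betw_def)
  have adj: "adjacent (beadset y) (\<psi> u) (\<psi> v) \<longleftrightarrow> adjacent (beadset x) u v"
    if "u \<in> beadset x" "v \<in> beadset x" for u v
  proof -
    have "\<psi> u \<in> beadset y" "\<psi> v \<in> beadset y" using that img by blast+
    moreover have "\<psi> u = \<psi> v \<longleftrightarrow> u = v" using inj that by (auto dest: inj_onD)
    ultimately show ?thesis unfolding adjacent_def img[symmetric] using that btw by auto
  qed
  have Ints: "\<psi> u \<in> \<int> \<longleftrightarrow> u \<in> \<int>" if u: "u \<in> beadset x" for u
  proof -
    have "\<psi> u \<in> \<int> \<longleftrightarrow> (\<exists>v\<in>beadset y. \<exists>v'\<in>beadset y. v \<noteq> v' \<and>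
        adjacent (beadset y) (\<psi> u) v \<and> adjacent (beadset y) (\<psi> u) v')"
      unfolding Ints_iff_two_neighbours[of "\<psi> u" y] by (auto simp: adjacent_def)
    also have "\<dots> \<longleftrightarrow> (\<exists>v\<in>beadset x. \<exists>v'\<in>beadset x. \<psi> v \<noteq> \<psi> v' \<and>
        adjacent (beadset y) (\<psi> u) (\<psi> v) \<and> adjacent (beadset y) (\<psi> u) (\<psi> v'))"
      unfolding img[symmetric] by blast
    also have "\<dots> \<longleftrightarrow> (\<exists>v\<in>beadset x. \<exists>v'\<in>beadset x. v \<noteq> v' \<and>
        adjacent (beadset x) u v \<and> adjacent (beadset x) u v')"
      using adj[OF u] inj by (auto simp: inj_on_eq_iff)
    also have "\<dots> \<longleftrightarrow> u \<in> \<int>"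
      unfolding Ints_iff_two_neighbours[of u x] by (auto simp: adjacent_def)
    finally show ?thesis .
  qed
  define f where "f n = \<lfloor>\<psi> (of_int n)\<rfloor>" for n
  have f: "\<psi> (of_int n) = of_int (f n)" for n
    using Ints[of "of_int n"] unfolding f_def by (simp add: of_int_floor)
  have "inj f"
  proof (rule injI)
    fix m n assume "f m = f n"
    then have "\<psi> (of_int m) = \<psi> (of_int n)" by (simp add: f)
    then show "m = n" using inj by (auto dest: inj_onD)
  qed
  have step: "\<bar>f (n + 1) - f n\<bar> = 1" for n
  proof (rule ccontr)
    assume ne: "\<bar>f (n + 1) - f n\<bar> \<noteq> 1"
    have "f (n + 1) \<noteq> f n" using \<open>inj f\<close> by (simp add: inj_eq)
    define m where "m = min (f n) (f (n + 1)) + 1"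
    have m: "between (of_int m) (of_int (f n)) (of_int (f (n + 1)))"
      using ne \<open>f (n + 1) \<noteq> f n\<close> unfolding between_def m_def of_int_less_iff by linarith
    have "of_int m \<in> \<psi> ` beadset x" by (simp add: img)
    then obtain u where u: "u \<in> beadset x" "\<psi> u = of_int m" by auto
    have "u \<in> \<int>" using Ints[OF u(1)] u(2) by simp
    then obtain j where j: "u = of_int j" by (auto elim: Ints_cases)
    have "between u (of_int n) (of_int (n + 1))"
      using m btw[of u "of_int n" "of_int (n + 1)"] u unfolding f by (simp only: of_int_in_beadset)
    then show False unfolding between_def j of_int_less_iff by linarith
  qed
  have key: "x n \<noteq> 0 \<longleftrightarrow> y (min (f n) (f (n + 1))) \<noteq> 0" for n
  proof -
    define m where "m = min (f n) (f (n + 1))"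
    have m: "between v (of_int (f n)) (of_int (f (n + 1))) \<longleftrightarrow> of_int m < v \<and> v < of_int m + 1" for v
    proof -
      have "f n = m \<and> f (n + 1) = m + 1 \<or> f (n + 1) = m \<and> f n = m + 1"
        using step[of n] unfolding m_def by linarith
      then show ?thesis by (auto simp: between_def)
    qed
    have "x n \<noteq> 0 \<longleftrightarrow> (\<exists>u\<in>beadset x. between u (of_int n) (of_int (n + 1)))"
      unfolding beadset_between_ints[symmetric] by (auto simp: between_def)
    also have "\<dots> \<longleftrightarrow> (\<exists>u\<in>beadset x. between (\<psi> u) (\<psi> (of_int n)) (\<psi> (of_int (n + 1))))"
      using btw[OF _ of_int_in_beadset of_int_in_beadset] by blast
    also have "\<dots> \<longleftrightarrow> (\<exists>v\<in>beadset y. between v (of_int (f n)) (of_int (f (n + 1))))"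
      unfolding f img[symmetric] by blast
    also have "\<dots> \<longleftrightarrow> y m \<noteq> 0" unfolding m by (rule beadset_between_ints)
    finally show ?thesis unfolding m_def .
  qed
  from int_unit_steps[OF \<open>inj f\<close> step] show ?thesis
  proof
    assume F: "\<forall>n. f n = f 0 + n"
    have "x n \<noteq> 0 \<longleftrightarrow> y (f 0 + n) \<noteq> 0" for n
    proof -
      have "min (f n) (f (n + 1)) = f 0 + n"
        unfolding F[rule_format, of n] F[rule_format, of "n + 1"] by simp
      then show ?thesis using key[of n] by simp
    qed
    then show ?thesis by blast
  next
    assume F: "\<forall>n. f n = f 0 - n"
    \<comment> \<open>A link is named by its left end, and the reflected link runs from
      \<open>f 0 - n - 1\<close> to \<open>f 0 - n\<close>; hence the extra 1.\<close>
    have "x n \<noteq> 0 \<longleftrightarrow> y (f 0 - 1 - n) \<noteq> 0" for n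
    proof -
      have "min (f n) (f (n + 1)) = f 0 - 1 - n"
        unfolding F[rule_format, of n] F[rule_format, of "n + 1"] by simp
      then show ?thesis using key[of n] by simp
    qed
    then show ?thesis by blast
  qed
qed

section \<open>The necklace of a sequence\<close>

definition bead_distance :: "(int \<Rightarrow> nat) \<Rightarrow> real \<Rightarrow> real" where
  "bead_distance x u = infdist u (beadset x)"

lemma beadset_nonempty [simp]: "beadset x \<noteq> {}"
  using of_int_in_beadset by blast

lemma bead_distance_nonneg [simp]: "0 \<le> bead_distance x u"
  by (simp add: bead_distance_def infdist_nonneg)

lemma bead_distance_le_1: "bead_distance x u \<le> 1"
  unfolding bead_distance_def
  by (rule infdist_le2[OF of_int_in_beadset[of "\<lfloor>u\<rfloor>"]]) (simp add: dist_real_def, linarith)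

lemma bead_distance_eq_0_iff: "bead_distance x u = 0 \<longleftrightarrow> u \<in> beadset x"
  unfolding bead_distance_def using in_closed_iff_infdist_zero[OF closed_beadset] by simp

lemma bead_distance_shift:
  "bead_distance (\<lambda>n. x (n + k)) u = bead_distance x (u + of_int k)"
proof -
  have "beadset x = (\<lambda>v. v + of_int k) ` beadset (\<lambda>n. x (n + k))"
  proof (intro set_eqI iffI)
    fix v assume "v \<in> beadset x"
    then have "v - of_int k \<in> beadset (\<lambda>n. x (n + k))"
      by (simp add: beadset_def frac_def)
    then show "v \<in> (\<lambda>v. v + of_int k) ` beadset (\<lambda>n. x (n + k))" by force
  qed (auto simp: beadset_def frac_def)
  then show ?thesis
    by (simp add: bead_distance_def infdist_def image_image dist_real_def)
qed

text \<open>The integers on either side of \<open>u\<close> belong to every bead set, so points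
  outside the unit interval of \<open>u\<close> cannot lower the distance, and inside it only the
  value at \<lfloor>u\<rfloor> counts. At each point the profile thus depends on a single coordinate
  of the sequence.\<close>

lemma bead_distance_local_le:
  assumes "x \<lfloor>u\<rfloor> = y \<lfloor>u\<rfloor>"
  shows "bead_distance x u \<le> bead_distance y u"
  unfolding bead_distance_def infdist_notempty[OF beadset_nonempty, of u y]
proof (rule cINF_greatest)
  fix z assume z: "z \<in> beadset y"
  define n where "n = \<lfloor>u\<rfloor>"
  have n: "of_int n \<le> u" "u < of_int n + 1" unfolding n_def by linarith+
  consider "z \<le> of_int n" | "of_int n < z" "z < of_int n + 1" | "z \<ge> of_int n + 1" by linarith
  then show "infdist u (beadset x) \<le> dist u z"
  proof cases
    case 1
    then show ?thesis using n by (intro infdist_le2[OF of_int_in_beadset[of n]]) (auto simp: dist_real_def)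
  next
    case 2
    then have "z \<in> beadset x" using z assms beadset_gap[of n z x] beadset_gap[of n z y] by (simp add: n_def)
    then show ?thesis by (rule infdist_le)
  next
    case 3
    then show ?thesis using n by (intro infdist_le2[OF of_int_in_beadset[of "n + 1"]]) (auto simp: dist_real_def)
  qed
qed simp

lemma bead_distance_local: "x \<lfloor>u\<rfloor> = y \<lfloor>u\<rfloor> \<Longrightarrow> bead_distance x u = bead_distance y u"
  by (intro antisym bead_distance_local_le) auto

text \<open>An order isomorphism from the open unit interval to the line. In this coordinate a
  translation of the line becomes a fractional linear map, which extends continuously to the ends 0
  and 1.\<close>

definition logit :: "real \<Rightarrow> real" where
  "logit t = log 2 (t / (1 - t))"

definition expit :: "real \<Rightarrow> real" where
  "expit u = 2 powr u / (1 + 2 powr u)"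

lemma expit_pos: "0 < expit u" and expit_less_1: "expit u < 1"
  by (simp_all add: expit_def add_pos_pos divide_less_eq)

lemma logit_expit [simp]: "logit (expit u) = u"
proof -
  have "1 + 2 powr u \<noteq> (0::real)" using powr_ge_zero[of 2 u] by linarith
  then have "1 - expit u = 1 / (1 + 2 powr u)" by (simp add: expit_def field_simps)
  then have "expit u / (1 - expit u) = 2 powr u"
    using \<open>1 + 2 powr u \<noteq> 0\<close> by (simp add: expit_def)
  then show ?thesis by (simp add: logit_def)
qed

lemma expit_logit [simp]:
  assumes "0 < t" "t < 1" shows "expit (logit t) = t"
  using assms by (simp add: expit_def logit_def powr_log_cancel field_simps)

lemma expit_less_iff [simp]: "expit u < expit v \<longleftrightarrow> u < v"
proof -
  have "1 + 2 powr u > (0::real)" "1 + 2 powr v > (0::real)" by (simp_all add: add_pos_pos)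
  then show ?thesis by (simp add: expit_def divide_simps algebra_simps)
qed

text \<open>The first two factors cancel the junk values of \<open>logit\<close> at 0 and 1.\<close>
definition wave :: "(int \<Rightarrow> nat) \<Rightarrow> real \<Rightarrow> real" where
  "wave x t = t * (1 - t) * bead_distance x (logit t)"

lemma wave_eq_0_iff: "0 < t \<Longrightarrow> t < 1 \<Longrightarrow> wave x t = 0 \<longleftrightarrow> logit t \<in> beadset x"
  by (simp add: wave_def bead_distance_eq_0_iff)

text \<open>Only the ends need care: \<open>bead_distance x (logit t)\<close> oscillates there, but
  it is bounded by 1 and the factor \<open>t * (1 - t)\<close> squeezes the product to 0.\<close>

lemma continuous_on_wave: "continuous_on {0..1} (wave x)"
proof -
  have le: "\<bar>wave x t\<bar> \<le> \<bar>t * (1 - t)\<bar>" for t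
    unfolding wave_def abs_mult[of "t * (1 - t)"]
    using bead_distance_le_1[of x "logit t"] by (intro mult_left_le) auto
  have end0: "isCont (wave x) t" if "t * (1 - t) = 0" for t
  proof -
    have "((\<lambda>s. s * (1 - s)) \<longlongrightarrow> t * (1 - t)) (at t)" by (intro tendsto_intros)
    then have "((\<lambda>s. s * (1 - s)) \<longlongrightarrow> 0) (at t)" using that by simp
    then have "(wave x \<longlongrightarrow> 0) (at t)"
      by (rule tendsto_0_le[where K = 1]) (use le in auto)
    moreover have "wave x t = 0" unfolding wave_def that by simp
    ultimately show ?thesis unfolding isCont_def by simp
  qed
  have "isCont (wave x) t" if "t \<in> {0..1}" for t
  proof (cases "t * (1 - t) = 0")
    case False
    then have "0 < t" "t < 1" using that by (auto simp: less_le)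
    then show ?thesis
      unfolding wave_def bead_distance_def logit_def
      by (intro continuous_intros) (auto intro: continuous_intros)
  qed (rule end0)
  then show ?thesis by (simp add: continuous_at_imp_continuous_on)
qed

lemma bead_profile_wave: "bead_profile (wave x)"
proof
  show "continuous_on {0..1} (wave x)" by (rule continuous_on_wave)
qed (simp_all add: wave_def)

text \<open>Translation of the line by \<open>- k\<close> is \<open>f\<close> on the unit interval.
  It multiplies the damping factor \<open>t * (1 - t)\<close> by its own derivative
  \<open>d t\<close>, and this is the vertical stretch.\<close>

lemma necklace_shift:
  "necklace (wave x) homeomorphic necklace (wave (\<lambda>n. x (n + k)))"
proof -
  define c where "c = 2 powr (- real_of_int k)"
  have "c > 0" by (simp add: c_def)
  define f where "f t = c * t / (1 - t + c * t)" for t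
  define d where "d t = c / (1 - t + c * t)\<^sup>2" for t
  have pos: "1 - t + c * t > 0" if "t \<in> {0..1}" for t
  proof (cases "t = 1")
    case False
    then show ?thesis using that \<open>c > 0\<close> by (intro add_pos_nonneg) auto
  qed (use \<open>c > 0\<close> in simp)
  have ne: "1 - t + c * t \<noteq> 0" if "t \<in> {0..1}" for t using pos[OF that] by simp
  have f1: "1 - f t = (1 - t) / (1 - t + c * t)" if "t \<in> {0..1}" for t
    using ne[OF that] by (simp add: f_def field_simps)
  show ?thesis
  proof (rule homeomorphic_necklace[OF bead_profile_wave, of f d])
    show "continuous_on {0..1} f" "continuous_on {0..1} d"
      unfolding f_def d_def using ne by (auto intro!: continuous_intros)
    show "d t > 0" if "t \<in> {0..1}" for t
      using pos[OF that] \<open>c > 0\<close> by (simp add: d_def)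
    show "bij_betw f {0..1} {0..1}"
    proof (rule bij_betwI)
      \<comment> \<open>The same fractional linear map with \<open>1 / c\<close> in place of
        \<open>c\<close>.\<close>
      define g where "g s = s / (c - c * s + s)" for s
      have gne: "c - c * s + s > 0" if "s \<in> {0..1}" for s
      proof (cases "s = 0")
        case False
        then show ?thesis using that \<open>c > 0\<close> by (intro add_nonneg_pos) auto
      qed (use \<open>c > 0\<close> in simp)
      show "f \<in> {0..1} \<rightarrow> {0..1}"
        using pos \<open>c > 0\<close> by (auto simp: f_def divide_le_eq intro!: divide_nonneg_pos)
      show "g \<in> {0..1} \<rightarrow> {0..1}"
        using gne \<open>c > 0\<close> by (auto simp: g_def divide_le_eq intro!: divide_nonneg_pos)
      show "g (f t) = t" if "t \<in> {0..1}" for t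
      proof -
        have "c - c * f t + f t = c * (1 - f t) + f t" by (simp add: algebra_simps)
        also have "\<dots> = (c * (1 - t) + c * t) / (1 - t + c * t)"
          unfolding f1[OF that] by (simp add: f_def add_divide_distrib)
        also have "\<dots> = c / (1 - t + c * t)" by (simp add: algebra_simps)
        finally have "g (f t) = f t / (c / (1 - t + c * t))" by (simp only: g_def)
        then show ?thesis using ne[OF that] \<open>c > 0\<close> by (simp add: f_def)
      qed
      show "f (g s) = s" if "s \<in> {0..1}" for s
      proof -
        have "1 = (c - c * s + s) / (c - c * s + s)" using gne[OF that] by simp
        then have "1 - g s + c * g s = (c - c * s + s - s + c * s) / (c - c * s + s)"
          unfolding g_def by (simp only: add_divide_distrib diff_divide_distrib times_divide_eq_right)
        also have "\<dots> = c / (c - c * s + s)" by simp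
        finally have "f (g s) = c * g s / (c / (c - c * s + s))" by (simp only: f_def)
        then show ?thesis using gne[OF that] \<open>c > 0\<close> by (simp add: g_def)
      qed
    qed
    show "wave (\<lambda>n. x (n + k)) (f t) = d t * wave x t" if "t \<in> {0..1}" for t
    proof (cases "t = 0 \<or> t = 1")
      case True
      then show ?thesis using \<open>c > 0\<close> by (auto simp: wave_def f_def)
    next
      case False
      then have t: "0 < t" "t < 1" using that by auto
      have "f t / (1 - f t) = c * (t / (1 - t))"
        unfolding f1[OF that] using ne[OF that] by (simp add: f_def)
      then have "logit (f t) = log 2 c + logit t"
        using t \<open>c > 0\<close> log_mult_pos[of c "t / (1 - t)" 2] unfolding logit_def by simp
      then have "logit (f t) + of_int k = logit t" by (simp add: c_def)
      then show ?thesis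
        using ne[OF that] unfolding wave_def bead_distance_shift f1[OF that]
        by (simp add: f_def d_def power2_eq_square)
    qed
  qed
qed

section \<open>Cut points of necklaces\<close>

definition cut_points :: "(real \<times> real) set \<Rightarrow> (real \<times> real) set" where
  "cut_points N = {r \<in> N. \<exists>p\<in>N. \<exists>q\<in>N. separates N r p q}"

lemma expit_in_necklace: "(expit u, 0) \<in> necklace (wave x) \<longleftrightarrow> u \<in> beadset x"
  using wave_eq_0_iff[of "expit u" x] expit_pos[of u] expit_less_1[of u]
  by (auto simp: necklace_def)

text \<open>The two ends lie on opposite sides of every pinch and are separated by it. Conversely a
  cut point has points on both sides, so its abscissa is strictly inside the unit interval, where
  \<open>logit\<close> is invertible.\<close>

lemma cut_points_necklace:
  "cut_points (necklace (wave x)) = (\<lambda>u. (expit u, 0)) ` beadset x" (is "?L = ?R")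
proof
  interpret bead_profile "wave x" by (rule bead_profile_wave)
  show "?L \<subseteq> ?R"
  proof
    fix r assume "r \<in> ?L"
    then obtain p q where r: "r \<in> necklace (wave x)" "p \<in> necklace (wave x)" "q \<in> necklace (wave x)"
        "separates (necklace (wave x)) r p q"
      unfolding cut_points_def by blast
    then have *: "snd r = 0" "fst p < fst r \<and> fst r < fst q \<or> fst q < fst r \<and> fst r < fst p"
      using separates_necklace by blast+
    have "fst p \<in> {0..1}" "fst q \<in> {0..1}" using r(2,3) by (auto simp: necklace_def)
    then have "0 < fst r" "fst r < 1" using *(2) by auto
    then have "r = (expit (logit (fst r)), 0)" using *(1) by (simp add: prod_eq_iff)
    then show "r \<in> ?R" using expit_in_necklace r(1) by (metis image_eqI)
  qed
  show "?R \<subseteq> ?L"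
  proof
    fix r assume "r \<in> ?R"
    then obtain u where u: "u \<in> beadset x" "r = (expit u, 0)" by blast
    then have r: "r \<in> necklace (wave x)" using expit_in_necklace by blast
    have ends: "(0, 0) \<in> necklace (wave x)" "(1, 0) \<in> necklace (wave x)" by (simp_all add: necklace_def)
    have "separates (necklace (wave x)) r (0, 0) (1, 0)"
      using separates_necklace[OF r ends] u(2) expit_pos expit_less_1 by simp
    then show "r \<in> ?L" unfolding cut_points_def using r ends by blast
  qed
qed

text \<open>A homeomorphism preserves \<open>separates\<close>, hence the cut points, and on these
  \<open>separates\<close> is betweenness of the line coordinates; \<psi> is the homeomorphism read
  in that coordinate.\<close>

lemma necklace_rigid:
  assumes "necklace (wave x) homeomorphic necklace (wave y)"
  shows "\<exists>k. (\<forall>n. x n \<noteq> 0 \<longleftrightarrow> y (k + n) \<noteq> 0) \<or> (\<forall>n. x n \<noteq> 0 \<longleftrightarrow> y (k - n) \<noteq> 0)"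
proof -
  let ?N = "necklace (wave x)" and ?M = "necklace (wave y)"
  define pt where "pt u = (expit u, 0::real)" for u
  have pt_N: "pt u \<in> necklace (wave z)" if "u \<in> beadset z" for u z
    unfolding pt_def using that expit_in_necklace by blast
  have inj_pt: "inj pt"
    by (rule injI) (metis pt_def logit_expit prod.inject)
  obtain h g where h: "homeomorphism ?N ?M h g" using assms unfolding homeomorphic_def by blast
  have "h ` cut_points ?N = cut_points ?M"
  proof -
    have "h ` cut_points ?N = {r \<in> h ` ?N. \<exists>p\<in>h ` ?N. \<exists>q\<in>h ` ?N. separates ?M r p q}"
      unfolding cut_points_def using separates_homeomorphism[OF h] by blast
    then show ?thesis by (simp add: homeomorphism_image1[OF h] cut_points_def)
  qed
  then have img: "h ` pt ` beadset x = pt ` beadset y"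
    unfolding cut_points_necklace pt_def .
  define \<psi> where "\<psi> u = logit (fst (h (pt u)))" for u
  have \<psi>: "\<psi> u \<in> beadset y \<and> h (pt u) = pt (\<psi> u)" if "u \<in> beadset x" for u
  proof -
    have "h (pt u) \<in> h ` pt ` beadset x" using that by simp
    then obtain v where "v \<in> beadset y" "h (pt u) = pt v" unfolding img by (rule imageE)
    moreover have "\<psi> u = v" unfolding \<psi>_def \<open>h (pt u) = pt v\<close> by (simp add: pt_def)
    ultimately show ?thesis by simp
  qed
  have inj_h: "inj_on h ?N" using h by (metis homeomorphism_def inj_on_inverseI)
  show ?thesis
  proof (rule beadset_rigid)
    show "bij_betw \<psi> (beadset x) (beadset y)"
    proof (rule bij_betw_imageI)
      show "inj_on \<psi> (beadset x)"
      proof (rule inj_onI)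
        fix u v assume u: "u \<in> beadset x" and v: "v \<in> beadset x" and "\<psi> u = \<psi> v"
        then have "h (pt u) = h (pt v)" using \<psi>[OF u] \<psi>[OF v] by simp
        then have "pt u = pt v" using inj_onD[OF inj_h _ pt_N[OF u] pt_N[OF v]] by blast
        then show "u = v" using inj_pt by (simp add: inj_eq)
      qed
      show "\<psi> ` beadset x = beadset y"
      proof
        show "beadset y \<subseteq> \<psi> ` beadset x"
        proof
          fix v assume "v \<in> beadset y"
          then have "pt v \<in> h ` pt ` beadset x" unfolding img by simp
          then obtain u where u: "u \<in> beadset x" "pt v = h (pt u)" by auto
          then have "v = \<psi> u" using \<psi>[OF u(1)] inj_pt by (simp add: inj_eq)
          then show "v \<in> \<psi> ` beadset x" using u(1) by blast
        qed
      qed (use \<psi> in blast)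
    qed
    show "between (\<psi> u) (\<psi> v) (\<psi> z) \<longleftrightarrow> between u v z"
      if u: "u \<in> beadset x" and v: "v \<in> beadset x" and z: "z \<in> beadset x" for u v z
    proof -
      have sep: "separates (necklace (wave s)) (pt a) (pt b) (pt c) \<longleftrightarrow> between a b c"
        if "a \<in> beadset s" "b \<in> beadset s" "c \<in> beadset s" for a b c s
      proof -
        interpret bead_profile "wave s" by (rule bead_profile_wave)
        show ?thesis using separates_necklace[of "pt a" "pt b" "pt c"] pt_N[OF that(1)] pt_N[OF that(2)] pt_N[OF that(3)]
          by (simp add: between_def pt_def)
      qed
      have "between (\<psi> u) (\<psi> v) (\<psi> z) \<longleftrightarrow> separates ?M (pt (\<psi> u)) (pt (\<psi> v)) (pt (\<psi> z))"
        using sep[of "\<psi> u" y "\<psi> v" "\<psi> z"] \<psi>[OF u] \<psi>[OF v] \<psi>[OF z] by blast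
      also have "\<dots> \<longleftrightarrow> separates ?M (h (pt u)) (h (pt v)) (h (pt z))"
        using \<psi>[OF u] \<psi>[OF v] \<psi>[OF z] by simp
      also have "\<dots> \<longleftrightarrow> separates ?N (pt u) (pt v) (pt z)"
        by (rule separates_homeomorphism[OF h pt_N[OF u] pt_N[OF v] pt_N[OF z]])
      also have "\<dots> \<longleftrightarrow> between u v z" by (rule sep[OF u v z])
      finally show ?thesis .
    qed
  qed
qed

section \<open>Product spaces of sequences\<close>

lemma completely_metrizable_space_fun_discrete:
  "completely_metrizable_space (euclidean :: ('i::countable \<Rightarrow> 'b::discrete_topology) topology)"
proof -
  have "(euclidean :: 'b topology) = discrete_topology UNIV"
    by (simp add: topology_eq open_discrete)
  then have "completely_metrizable_space (euclidean :: 'b topology)"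
    by (simp add: completely_metrizable_space_discrete_topology)
  then show ?thesis
    unfolding euclidean_product_topology[symmetric] completely_metrizable_space_product_topology by auto
qed

lemma open_fun_cylinder:
  fixes V :: "('i \<Rightarrow> 'b::topological_space) set"
  assumes "open V" "v \<in> V"
  obtains F where "finite F" "\<And>z. (\<And>i. i \<in> F \<Longrightarrow> z i = v i) \<Longrightarrow> z \<in> V"
proof -
  have "openin (product_topology (\<lambda>i. euclidean) UNIV) V"
    using assms(1) by (simp add: open_fun_def)
  from product_topology_open_contains_basis[OF this assms(2)]
  obtain X where X: "v \<in> (\<Pi>\<^sub>E i\<in>UNIV. X i)" "finite {i. X i \<noteq> UNIV}" "(\<Pi>\<^sub>E i\<in>UNIV. X i) \<subseteq> V"
    by auto
  have "z \<in> V" if "\<And>i. i \<in> {i. X i \<noteq> UNIV} \<Longrightarrow> z i = v i" for z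
  proof -
    have "z i \<in> X i" for i using that[of i] X(1) by (cases "X i = UNIV") (auto simp: PiE_iff)
    then show ?thesis using X(3) by (auto simp: PiE_iff subset_iff)
  qed
  then show ?thesis using that X(2) by blast
qed

section \<open>The shift and the zero-one law\<close>

definition shift :: "int \<Rightarrow> (int \<Rightarrow> 'b) \<Rightarrow> int \<Rightarrow> 'b" where
  "shift k x = (\<lambda>n. x (n + k))"

lemma shift_shift [simp]: "shift k (shift l x) = shift (k + l) x" and shift_0 [simp]: "shift 0 x = x"
  by (simp_all add: shift_def add.assoc)

lemma continuous_on_shift: "continuous_on UNIV (shift k :: (int \<Rightarrow> 'b::topological_space) \<Rightarrow> _)"
  unfolding shift_def by (intro continuous_on_coordinatewise_then_product) simp

lemma meager_shift_vimage:
  assumes "meager (A :: (int \<Rightarrow> 'b::topological_space) set)"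
  shows "meager (shift k -` A)"
proof -
  obtain \<G> where \<G>: "countable \<G>" "\<And>G. G \<in> \<G> \<Longrightarrow> closed G \<and> interior G = {}" "A \<subseteq> \<Union>\<G>"
    using assms unfolding meager_def by blast
  have "meager (shift k -` G)" if G: "G \<in> \<G>" for G
  proof (rule meager_nowhere_dense)
    show "closed (shift k -` G)"
      using \<G>(2)[OF G] continuous_on_shift by (intro closed_vimage) auto
    define I where "I = interior (shift k -` G)"
    have "open (shift (- k) -` I)"
      using continuous_on_shift[of "- k"] by (intro open_vimage) (auto simp: I_def)
    moreover have "shift (- k) -` I \<subseteq> G"
    proof
      fix x assume "x \<in> shift (- k) -` I"
      then have "shift (- k) x \<in> shift k -` G" using interior_subset unfolding I_def by blast
      then show "x \<in> G" by simp
    qed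
    ultimately have "shift (- k) -` I \<subseteq> interior G" by (rule interior_maximal[rotated])
    then have "shift (- k) -` I = {}" using \<G>(2)[OF G] by simp
    moreover have "I = shift k -` shift (- k) -` I" by (auto simp: vimage_def)
    ultimately show "interior (shift k -` G) = {}" unfolding I_def by simp
  qed
  then have "meager (\<Union>G\<in>\<G>. shift k -` G)" using \<G>(1) by (intro meager_UN)
  then show ?thesis by (rule meager_subset) (use \<G>(3) in blast)
qed

lemma shift_transitive:
  fixes V W :: "(int \<Rightarrow> 'b::topological_space) set"
  assumes "open V" "open W" "V \<noteq> {}" "W \<noteq> {}"
  shows "\<exists>k. shift k -` V \<inter> W \<noteq> {}"
proof -
  obtain v w where v: "v \<in> V" and w: "w \<in> W" using assms by blast
  obtain F where F: "finite F" "\<And>z. (\<And>i. i \<in> F \<Longrightarrow> z i = v i) \<Longrightarrow> z \<in> V"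
    using open_fun_cylinder[OF assms(1) v] by blast
  obtain H where H: "finite H" "\<And>z. (\<And>i. i \<in> H \<Longrightarrow> z i = w i) \<Longrightarrow> z \<in> W"
    using open_fun_cylinder[OF assms(2) w] by blast
  \<comment> \<open>Moves all of \<open>F\<close> past the largest element of \<open>H\<close>, so
    that both finite prescriptions are compatible; \<open>insert 0\<close> covers empty
    sets.\<close>
  define k where "k = Max (insert 0 H) - Min (insert 0 F) + 1"
  have sep: "i + k \<notin> H" if "i \<in> F" for i
  proof
    assume "i + k \<in> H"
    then have "i + k \<le> Max (insert 0 H)" using H(1) by simp
    moreover have "Min (insert 0 F) \<le> i" using F(1) that by simp
    ultimately show False by (simp add: k_def)
  qed
  define z where "z i = (if i \<in> H then w i else v (i - k))" for i
  have "z \<in> W" by (rule H(2)) (simp add: z_def)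
  moreover have "shift k z \<in> V" by (rule F(2)) (simp add: shift_def z_def sep)
  ultimately show ?thesis by blast
qed

text \<open>A shift of \<open>V\<close> overlaps \<open>W\<close> in a nonempty open set. Up to
  meager sets this overlap lies in \<open>A\<close>, by invariance, and in \<open>B\<close>; if
  these were disjoint it would be meager, against the Baire category theorem.\<close>

lemma shift_invariant_Int:
  fixes A B :: "(int \<Rightarrow> 'b::discrete_topology) set"
  assumes A: "\<And>k x. shift k x \<in> A \<Longrightarrow> x \<in> A"
    and V: "open V" "V \<noteq> {}" "meager (V - A)" and W: "open W" "W \<noteq> {}" "meager (W - B)"
  shows "A \<inter> B \<noteq> {}"
proof
  assume disj: "A \<inter> B = {}"
  obtain k where k: "shift k -` V \<inter> W \<noteq> {}" using shift_transitive V(1,2) W(1,2) by blast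
  have "open (shift k -` V \<inter> W)"
    using V(1) W(1) continuous_on_shift[of k] by (intro open_Int open_vimage) auto
  moreover have "meager (shift k -` V \<inter> W)"
  proof (rule meager_subset)
    show "meager (shift k -` (V - A) \<union> (W - B))"
      using V(3) W(3) by (intro meager_Un meager_shift_vimage)
    show "shift k -` V \<inter> W \<subseteq> shift k -` (V - A) \<union> (W - B)" using A disj by blast
  qed
  ultimately show False using k not_meager_open[OF completely_metrizable_space_fun_discrete] by blast
qed

text \<open>Each coordinate imposes a closed condition, while a basic open set leaves some
  coordinate \<open>n\<close> free, where a value violating the condition can be chosen.\<close>

lemma meager_prescribed_support:
  "meager {x :: int \<Rightarrow> nat. \<forall>n. x n \<noteq> 0 \<longleftrightarrow> b n}"
proof (rule meager_nowhere_dense)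
  have "{x :: int \<Rightarrow> nat. \<forall>n. x n \<noteq> 0 \<longleftrightarrow> b n} = (\<Inter>n. (\<lambda>x. x n) -` {m. m \<noteq> 0 \<longleftrightarrow> b n})" by auto
  moreover have "closed ((\<lambda>x :: int \<Rightarrow> nat. x n) -` {m. m \<noteq> 0 \<longleftrightarrow> b n})" for n
    by (intro closed_vimage continuous_on_product_coordinates) (simp add: closed_def open_discrete)
  ultimately show "closed {x :: int \<Rightarrow> nat. \<forall>n. x n \<noteq> 0 \<longleftrightarrow> b n}" by auto
  show "interior {x :: int \<Rightarrow> nat. \<forall>n. x n \<noteq> 0 \<longleftrightarrow> b n} = {}"
  proof (rule ccontr)
    assume "interior {x :: int \<Rightarrow> nat. \<forall>n. x n \<noteq> 0 \<longleftrightarrow> b n} \<noteq> {}"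
    then obtain v where v: "v \<in> interior {x :: int \<Rightarrow> nat. \<forall>n. x n \<noteq> 0 \<longleftrightarrow> b n}" by blast
    obtain F where F: "finite F" "\<And>z. (\<And>i. i \<in> F \<Longrightarrow> z i = v i) \<Longrightarrow>
        z \<in> interior {x :: int \<Rightarrow> nat. \<forall>n. x n \<noteq> 0 \<longleftrightarrow> b n}"
      using open_fun_cylinder[OF open_interior v] by blast
    obtain n where "n \<notin> F" using F(1) infinite_UNIV_int ex_new_if_finite by blast
    define z where "z = v(n := if b n then 0 else 1)"
    have "z \<in> interior {x. \<forall>n. x n \<noteq> 0 \<longleftrightarrow> b n}"
      by (rule F(2)) (use \<open>n \<notin> F\<close> in \<open>auto simp: z_def\<close>)
    then have "z n \<noteq> 0 \<longleftrightarrow> b n" using interior_subset by blast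
    then show False by (simp add: z_def split: if_splits)
  qed
qed

lemma meager_necklace_class:
  "meager {x. necklace (wave x) homeomorphic necklace (wave y)}"
proof -
  define L :: "int \<Rightarrow> (int \<Rightarrow> nat) set" where
    "L k = {x. \<forall>n. x n \<noteq> 0 \<longleftrightarrow> y (k + n) \<noteq> 0} \<union> {x. \<forall>n. x n \<noteq> 0 \<longleftrightarrow> y (k - n) \<noteq> 0}" for k
  have "meager (\<Union>k. L k)"
    unfolding L_def by (intro meager_UN meager_Un meager_prescribed_support) simp
  moreover have "x \<in> (\<Union>k. L k)" if "necklace (wave x) homeomorphic necklace (wave y)" for x
    using necklace_rigid[OF that] unfolding L_def by simp
  ultimately show ?thesis by (elim meager_subset) blast
qed

text \<open>At a fixed abscissa the profile depends only on the coordinate of \<open>x\<close> at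
  the integer part of \<open>logit t\<close>, and every function on a discrete space is
  continuous.\<close>

lemma continuous_on_wave_param: "continuous_on UNIV (\<lambda>x. wave x t)"
proof -
  have "bead_distance x u = bead_distance (\<lambda>_. x \<lfloor>u\<rfloor>) u" for x u
    by (rule bead_distance_local) simp
  then have "(\<lambda>x. wave x t) = (\<lambda>m. t * (1 - t) * bead_distance (\<lambda>_. m) (logit t)) \<circ> (\<lambda>x. x \<lfloor>logit t\<rfloor>)"
    by (auto simp: wave_def fun_eq_iff)
  then show ?thesis
    by (simp only:) (intro continuous_on_compose continuous_on_product_coordinates Topological_Spaces.continuous_on_discrete)
qed

text \<open>Abscissae and signs come from one countable set independent of \<open>x\<close>; only
  the heights move, and they move continuously.\<close>

lemma necklace_dense_sequence:
  obtains a :: "nat \<Rightarrow> (int \<Rightarrow> nat) \<Rightarrow> real \<times> real"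
  where "\<And>k. continuous_on UNIV (a k)" "\<And>x. necklace (wave x) = closure (range (\<lambda>k. a k x))"
proof -
  obtain D :: "real set" where D: "countable D" "D \<subseteq> {0..1}" "{0..1} \<subseteq> closure D"
    using separable by blast
  have clD: "closure D = {0..1}" using D(2,3) closure_minimal[of D "{0..1}"] by auto
  then have "D \<noteq> {}" by auto
  define E where "E = {1, -1 :: real} \<times> D"
  have E: "range (from_nat_into E) = E"
    using D(1) \<open>D \<noteq> {}\<close> by (intro range_from_nat_into) (auto simp: E_def)
  define a where "a k x = (case from_nat_into E k of (e, t) \<Rightarrow> (t, e * wave x t))" for k x
  have "continuous_on UNIV (a k)" for k
    unfolding a_def by (cases "from_nat_into E k") (auto intro!: continuous_intros continuous_on_wave_param)
  moreover have "necklace (wave x) = closure (range (\<lambda>k. a k x))" for x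
  proof -
    interpret bead_profile "wave x" by (rule bead_profile_wave)
    have "range (\<lambda>k. a k x) = (\<lambda>(e, t). (t, e * wave x t)) ` range (from_nat_into E)"
      unfolding a_def image_image ..
    also have "\<dots> = (\<lambda>(e, t). (t, e * wave x t)) ` E" by (simp only: E)
    also have "\<dots> = (\<Union>e\<in>{1, -1}. arc e D)" unfolding E_def arc_def by force
    finally show ?thesis using necklace_eq_closure[OF clD] by (simp only:)
  qed
  ultimately show ?thesis by (rule that)
qed

lemma necklaces_not_unique_components:
  fixes S :: "'x::{metric_space, second_countable_topology} set"
  assumes S: "compact S"
  shows "\<not> (\<forall>x. \<exists>!D. D \<in> connected_components_of (top_of_set S) \<and> necklace (wave x) homeomorphic D)"
proof
  assume ex1: "\<forall>x. \<exists>!D. D \<in> connected_components_of (top_of_set S) \<and> necklace (wave x) homeomorphic D"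
  have nm: "\<not> meager (UNIV :: (int \<Rightarrow> nat) set)"
    by (rule not_meager_open[OF completely_metrizable_space_fun_discrete]) auto
  let ?comp = "connected_components_of (top_of_set S)"
  obtain c where c: "\<And>x. c x \<in> ?comp" "\<And>x. necklace (wave x) homeomorphic c x"
      and c_unique: "\<And>x D. D \<in> ?comp \<Longrightarrow> necklace (wave x) homeomorphic D \<Longrightarrow> D = c x"
    using ex1 by metis
  have c_eq: "c x = c y" if "necklace (wave x) homeomorphic necklace (wave y)" for x y
    using c_unique[OF c(1)[of y], of x] homeomorphic_trans[OF that c(2)[of y]] by simp
  obtain a :: "nat \<Rightarrow> (int \<Rightarrow> nat) \<Rightarrow> real \<times> real" where a: "\<And>k. continuous_on UNIV (a k)"
      "\<And>x. necklace (wave x) = closure (range (\<lambda>k. a k x))"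
    using necklace_dense_sequence by blast
  define A where "A U = {x. c x \<subseteq> U}" for U
  \<comment> \<open>Uniqueness enters here: a property of the chosen component becomes an
    existential one, to which \<open>component_dichotomy\<close> applies.\<close>
  have A_eq: "A U = {x. \<exists>D\<in>?comp. D \<subseteq> U \<and> necklace (wave x) homeomorphic D}" for U
    unfolding A_def using c c_unique by blast
  have c_ne: "c x \<noteq> {}" for x using nonempty_connected_components_of[OF c(1)] .
  have c_S: "c x \<subseteq> S" for x using connected_components_of_subset[OF c(1)[of x]] by simp
  have A_inv: "shift k x \<in> A U \<Longrightarrow> x \<in> A U" for k x U
    unfolding A_def using c_eq[OF necklace_shift[of x k]] by (simp add: shift_def)
  have clopen_compl: "S - U \<in> clopen_in S" if "U \<in> clopen_in S" for U
    using that by (auto simp: clopen_in_def)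
  have compact_N: "compact (necklace (wave x))" and connected_N: "connected (necklace (wave x))" for x
    using bead_profile.compact_necklace[OF bead_profile_wave] bead_profile.connected_necklace[OF bead_profile_wave] by blast+
  have dich: "\<exists>V. open V \<and> V \<noteq> {} \<and> meager (V - A U)" if "U \<in> clopen_in S" "\<not> meager (A U)" for U
    by (rule component_dichotomy[OF S that(1) a compact_N connected_N A_eq[of U] that(2)])
  \<comment> \<open>If neither were meager, each would be comeager in some nonempty open set, and by
    shift invariance they would meet; but no nonempty component lies in both \<open>U\<close> and
    \<open>S - U\<close>.\<close>
  have zero_one: "meager (A U) \<or> meager (A (S - U))" if U: "U \<in> clopen_in S" for U
  proof (rule ccontr)
    assume "\<not> (meager (A U) \<or> meager (A (S - U)))"
    then obtain V W where "open V" "V \<noteq> {}" "meager (V - A U)" "open W" "W \<noteq> {}" "meager (W - A (S - U))"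
      using dich[OF U] dich[OF clopen_compl[OF U]] by blast
    then have "A U \<inter> A (S - U) \<noteq> {}" using A_inv by (intro shift_invariant_Int[of "A U"])
    then show False using c_ne unfolding A_def by blast
  qed
  \<comment> \<open>For a point \<open>x\<close> outside \<open>G\<close>, the set
    \<open>A U\<close> is nonmeager whenever the clopen set \<open>U\<close> contains
    \<open>c x\<close>.\<close>
  define G where "G = (\<Union>U\<in>{U \<in> clopen_in S. meager (A U)}. A U)"
  have "meager G"
    unfolding G_def using countable_clopen_in[OF S] by (intro meager_UN) auto
  then obtain x where x: "x \<notin> G" using nm meager_subset[of G UNIV] by auto
  have "c y = c x" if y: "y \<notin> G" for y
  proof (rule ccontr)
    assume "c y \<noteq> c x"
    then have disj: "c y \<inter> c x = {}"
      using pairwiseD[OF pairwise_disjoint_connected_components_of c(1)[of y] c(1)[of x]] by (simp add: disjnt_def)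
    have "compact (c y)"
      using homeomorphic_compactness[OF c(2)[of y]] compact_N by blast
    then have "open (- c y)" by (simp add: compact_imp_closed open_Compl)
    \<comment> \<open>A clopen set separating the two components: one of \<open>A U\<close> and
      \<open>A (S - U)\<close> is meager, and then \<open>G\<close> contains \<open>x\<close> or
      \<open>y\<close>.\<close>
    then obtain U where U: "U \<in> clopen_in S" "c x \<subseteq> U" "U \<subseteq> - c y"
      using component_clopen_neighbourhood[OF S c(1)[of x]] disj by blast
    have "\<not> meager (A U)" using x U unfolding G_def A_def by blast
    then have "meager (A (S - U))" using zero_one[OF U(1)] by blast
    then have "y \<notin> A (S - U)" using y clopen_compl[OF U(1)] unfolding G_def by blast
    then show False using U(3) c_S[of y] unfolding A_def by blast
  qed
  then have "necklace (wave y) homeomorphic necklace (wave x)" if "y \<notin> G" for y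
    using c(2)[of x] c(2)[of y] that homeomorphic_trans homeomorphic_sym by metis
  then have "UNIV \<subseteq> G \<union> {y. necklace (wave y) homeomorphic necklace (wave x)}" by blast
  moreover have "meager \<dots>" using \<open>meager G\<close> meager_necklace_class by (rule meager_Un)
  ultimately show False using nm meager_subset by auto
qed

section \<open>Transfer to arbitrary compact metrizable spaces\<close>

lemma compact_metrizable_embedding:
  assumes "compact_space X" "metrizable_space X" "topspace X \<noteq> {}"
  obtains f :: "'a \<Rightarrow> nat \<Rightarrow> real" where "embedding_map X euclidean f"
proof -
  obtain M d where "Metric_space M d" and X: "X = Metric_space.mtopology M d"
    using assms(2) unfolding metrizable_space_def by blast
  interpret Metric_space M d by fact
  have M: "M \<noteq> {}" "mtotally_bounded M" "compact_space mtopology"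
    using assms(1,3) X compact_space_eq_mcomplete_mtotally_bounded by auto
  then have "\<forall>n. \<exists>K. finite K \<and> K \<subseteq> M \<and> M \<subseteq> (\<Union>x\<in>K. mball x (inverse (real (Suc n))))"
    unfolding mtotally_bounded_def by simp
  then obtain K where K: "\<And>n. finite (K n)" "\<And>n. K n \<subseteq> M"
      "\<And>n. M \<subseteq> (\<Union>x\<in>K n. mball x (inverse (real (Suc n))))"
    by metis
  define s where "s = from_nat_into (\<Union>n. K n)"
  have s: "range s = (\<Union>n. K n)"
    unfolding s_def using K(1,3) M(1) by (intro range_from_nat_into) (auto simp: countable_finite)
  have s_M: "s n \<in> M" for n using s K(2) by blast
  \<comment> \<open>Distances to a countable dense set separate points. The resulting embedding
    carries a topology on an arbitrary type to a subset of a type of class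
    \<open>metric_space\<close>, where components can be coded by sequences.\<close>
  define f where "f x n = d x (s n)" for x n
  have "continuous_map mtopology (product_topology (\<lambda>_. euclideanreal) UNIV) f"
  proof (subst continuous_map_componentwise_UNIV, intro allI)
    fix n
    have "continuous_map mtopology euclidean (\<lambda>x. mdist (metric (M, d)) x (s n))"
      by (rule continuous_map_mdist) (use s_M in \<open>auto simp: mtopology_of_def\<close>)
    then show "continuous_map mtopology euclideanreal (\<lambda>x. f x n)" by (simp add: f_def)
  qed
  moreover have "inj_on f (topspace mtopology)"
  proof (rule inj_onI, rule ccontr)
    fix x y assume xy: "x \<in> topspace mtopology" "y \<in> topspace mtopology" "f x = f y" "x \<noteq> y"
    then have "d x y / 2 > 0" by simp
    then obtain n where n: "inverse (real (Suc n)) < d x y / 2" using reals_Archimedean by blast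
    obtain a where a: "a \<in> K n" "d a x < inverse (real (Suc n))"
      using K(3)[of n] xy(1) by (auto simp: subset_iff)
    then obtain m where m: "s m = a" using s by (metis UN_I UNIV_I imageE)
    have "d x a = d y a" using xy(3) m by (auto simp: f_def fun_eq_iff)
    moreover have "d x y \<le> d x a + d a y" using triangle[of x a y] xy s_M[of m] m by simp
    ultimately show False using a n commute[of a x] commute[of a y] by linarith
  qed
  ultimately have "embedding_map mtopology (product_topology (\<lambda>_. euclideanreal) UNIV) f"
    using M(3) by (intro continuous_imp_embedding_map) (auto simp: Hausdorff_space_product_topology)
  then show ?thesis using that X by (simp add: euclidean_product_topology)
qed

lemma homeomorphic_iff_homeomorphic_space:
  "S homeomorphic T \<longleftrightarrow> top_of_set S homeomorphic_space top_of_set T"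
proof -
  have "homeomorphism S T f g \<longleftrightarrow> homeomorphic_maps (top_of_set S) (top_of_set T) f g" for f g
  proof
    show "homeomorphism S T f g" if "homeomorphic_maps (top_of_set S) (top_of_set T) f g"
      using that unfolding homeomorphic_maps_def homeomorphism_def
      by (auto simp: continuous_map_in_subtopology Pi_iff intro: rev_image_eqI)
  qed (auto simp: homeomorphic_maps_def homeomorphism_def continuous_map_in_subtopology)
  then show ?thesis unfolding homeomorphic_def homeomorphic_space_def by simp
qed

theorem corollary8:
  shows "\<not> uniquely_compactifiable TYPE('a) all_continua"
proof
  assume "uniquely_compactifiable TYPE('a) all_continua"
  then obtain X :: "'a topology" where X: "compact_space X" "metrizable_space X"
      "\<forall>C\<in>all_continua. \<exists>!D. D \<in> connected_components_of X \<and> subtopology X D homeomorphic_space C"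
    unfolding uniquely_compactifiable_def by (elim exE conjE)
  \<comment> \<open>\<open>all_continua\<close> consists of topologies on real sequences, so the
    necklace, a subset of the plane, is replaced by a homeomorphic copy there.\<close>
  have uniq: "\<exists>!D. D \<in> connected_components_of X \<and> subtopology X D homeomorphic_space top_of_set (necklace (wave x))" for x
  proof -
    interpret bead_profile "wave x" by (rule bead_profile_wave)
    have "continuum (top_of_set (necklace (wave x)))"
      using compact_necklace connected_necklace metrizable_space_subtopology[OF metrizable_space_euclidean]
      by (auto simp: continuum_def compact_space_subtopology connected_space_subtopology necklace_def)
    then obtain C where C: "C \<in> all_continua" "top_of_set (necklace (wave x)) homeomorphic_space C"
      using continuum_copy_in_sequences by blast
    then have "subtopology X D homeomorphic_space C \<longleftrightarrow>
        subtopology X D homeomorphic_space top_of_set (necklace (wave x))" for D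
      by (meson homeomorphic_space_sym homeomorphic_space_trans)
    then show ?thesis using bspec[OF X(3) C(1)] by simp
  qed
  then have "connected_components_of X \<noteq> {}" by blast
  then have "topspace X \<noteq> {}" by (metis connected_components_of_eq_empty null_topspace_iff_trivial)
  then obtain f :: "'a \<Rightarrow> nat \<Rightarrow> real" where "embedding_map X euclidean f"
    using compact_metrizable_embedding X(1,2) by blast
  define S where "S = f ` topspace X"
  have f: "homeomorphic_map X (top_of_set S) f"
    using \<open>embedding_map X euclidean f\<close> unfolding embedding_map_def S_def .
  have inj: "inj_on f (topspace X)" using f by (rule homeomorphic_imp_injective_map)
  have comps: "connected_components_of (top_of_set S) = (`) f ` connected_components_of X"
    by (rule homeomorphic_map_connected_components_of[OF f])
  have hom: "necklace (wave x) homeomorphic f ` D \<longleftrightarrow>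
      subtopology X D homeomorphic_space top_of_set (necklace (wave x))"
    if "D \<in> connected_components_of X" for x D
  proof -
    have D: "D \<subseteq> topspace X" using that by (rule connected_components_of_subset)
    then have sub: "S \<inter> f ` D = f ` D" by (auto simp: S_def)
    have "homeomorphic_map (subtopology X D) (subtopology (top_of_set S) (f ` D)) f"
      by (rule homeomorphic_map_subtopologies[OF f]) (use D in \<open>auto simp: S_def\<close>)
    then have "subtopology X D homeomorphic_space top_of_set (f ` D)"
      using homeomorphic_map_imp_homeomorphic_space by (fastforce simp: subtopology_subtopology sub)
    then show ?thesis
      unfolding homeomorphic_iff_homeomorphic_space
      by (meson homeomorphic_space_sym homeomorphic_space_trans)
  qed
  have "compact S"
    using homeomorphic_compact_space[OF homeomorphic_map_imp_homeomorphic_space[OF f]] X(1)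
    by (simp add: compact_space_subtopology compactin_subtopology compact_space_def)
  moreover have "\<exists>!D. D \<in> connected_components_of (top_of_set S) \<and> necklace (wave x) homeomorphic D" for x
  proof -
    obtain D where D: "D \<in> connected_components_of X"
        "subtopology X D homeomorphic_space top_of_set (necklace (wave x))"
      and D': "\<And>D'. D' \<in> connected_components_of X \<Longrightarrow>
        subtopology X D' homeomorphic_space top_of_set (necklace (wave x)) \<Longrightarrow> D' = D"
      using uniq[of x] by blast
    show ?thesis
    proof (intro ex1I[of _ "f ` D"] conjI)
      show "f ` D \<in> connected_components_of (top_of_set S)" using D(1) comps by blast
      show "necklace (wave x) homeomorphic f ` D" using hom[OF D(1)] D(2) by blast
      fix E assume E: "E \<in> connected_components_of (top_of_set S) \<and> necklace (wave x) homeomorphic E"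
      then obtain D' where "D' \<in> connected_components_of X" "E = f ` D'" using comps by blast
      then show "E = f ` D" using D' hom E by blast
    qed
  qed
  ultimately show False using necklaces_not_unique_components by blast
qed

end
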